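(* Let $\mathcal{A}$ be a rational polygon. There exist a positive integer $k$ and rational numbers $r_1,\dots,r_k,f_1,\dots,f_k$ with all $f_j>0$ such that \[E_{\mathcal{A}}(t)=\sum_{j=1}^k r_jE_\Delta(f_jt)+O(t),\] where the implicit constant may depend on $\mathcal{A}$. Furthermore, if $\mathcal{A}$ is origin-star-shaped, then the $r_j$ may all be taken to be positive.
   Context: A rational polygon is a polygon all of whose vertices have rational coordinates; $\mathcal A$ is origin-star-shaped if $\lambda\mathcal A\subset\mathcal A$ for all $\lambda\in[0,1]$. $\mathcal{P}=\{(m,n)\in\mathbb{Z}^2:\gcd(m,n)=1\}$, $E_{\mathcal{A}}(t)=\#(t\mathcal{A}\cap\mathcal{P})-\frac{6}{\pi^2}t^2\,\mathrm{Area}(\mathcal{A})$, and $E_\Delta(t)=\sum_{1\le m\le t}\phi(m)-\frac{3}{\pi^2}t^2+1$ with $\phi$ Euler's totient function. *)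

theory Defs
  imports "HOL-Analysis.Analysis" "HOL-Number_Theory.Totient" "HOL-Library.Landau_Symbols"
begin

fun polygonal_path :: "'a::real_normed_vector list \<Rightarrow> real \<Rightarrow> 'a" where
  "polygonal_path [] = linepath 0 0"
| "polygonal_path [a] = linepath a a"
| "polygonal_path [a, b] = linepath a b"
| "polygonal_path (a # b # c # vs) = linepath a b +++ polygonal_path (b # c # vs)"

text \<open>A polygon is the closed region bounded by a simple closed polygonal curve; it need not be
  convex. Simplicity of the closed curve already excludes vertex lists of length at most 2.
  Vertices at which the angle is straight are permitted, so one polygon has several vertex lists.\<close>

definition polygon_with_vertices :: "(real^2) list \<Rightarrow> (real^2) set \<Rightarrow> bool" where
  "polygon_with_vertices vs A \<longleftrightarrow>
     (let c = polygonal_path (vs @ [hd vs])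
      in simple_path c \<and> A = path_image c \<union> inside (path_image c))"

definition rational_polygon :: "(real^2) set \<Rightarrow> bool" where
  "rational_polygon A \<longleftrightarrow>
     (\<exists>vs. polygon_with_vertices vs A \<and> (\<forall>v\<in>set vs. v $ 1 \<in> \<rat> \<and> v $ 2 \<in> \<rat>))"

definition origin_star_shaped :: "'a::real_vector set \<Rightarrow> bool" where
  "origin_star_shaped A \<longleftrightarrow> (\<forall>l\<in>{0..1::real}. (*\<^sub>R) l ` A \<subseteq> A)"

definition primitive_points :: "(real^2) set" where
  "primitive_points = {vector [of_int m, of_int n] | m n :: int. gcd m n = 1}"

definition E_polygon :: "(real^2) set \<Rightarrow> real \<Rightarrow> real" where
  "E_polygon A t =
     real (card ((*\<^sub>R) t ` A \<inter> primitive_points)) - 6 / pi\<^sup>2 * t\<^sup>2 * measure lebesgue A"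

definition E_Delta :: "real \<Rightarrow> real" where
  "E_Delta t =
     (\<Sum>m | 1 \<le> m \<and> real m \<le> t. real (totient m)) - 3 / pi\<^sup>2 * t\<^sup>2 + 1"

end

theory Submission
  imports Defs "HOL-Computational_Algebra.Squarefree"
begin

text \<open>After a unimodular change of coordinates \<open>(j,k)\<close>, a rational triangle with a vertex at the origin is
  \<open>0 < j \<le> f\<close>, \<open>A j < k \<le> B j\<close> with rational \<open>A < B\<close>. Its primitive points are counted by
  \<open>\<Sum>j\<le>f t. #{k. A j < k \<le> B j, gcd j k = 1}\<close>. Since \<open>\<lfloor>B e\<rfloor> - \<lfloor>A e\<rfloor> - (B - A) e\<close> is periodic in \<open>e\<close>, its
  partial sums are \<open>\<kappa> M + O(1)\<close>, and Moebius inversion together with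
  \<open>\<Sum>d\<le>N. \<mu>(d) \<lfloor>N/d\<rfloor> = 1\<close> gives \<open>(B - A) \<Sum>j\<le>f t. \<phi>(j) + O(t)\<close>: the error terms of the two sides are
  \<open>E(t)\<close> and \<open>(B - A) E\<^sub>\<Delta>(f t)\<close>.

  A bounded set whose boundary lies on finitely many rational lines has, off finitely many lines, an
  indicator function that is a signed sum of indicators of such triangles: cut the plane into wedges by the rays
  through all intersection points of the lines; inside a wedge the lines do not cross, so they are linearly ordered by
  distance from the origin, and the coefficient of a line is the jump of the indicator function across it.
  For a star-shaped set every jump is nonnegative. Finitely many lines carry only \<open>O(t)\<close> primitive points.\<close>

section \<open>Coprime counts in intervals with rational endpoints\<close>

text \<open>The delicate point is an error O(t) instead of O(t log t). In the Moebius formula the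
  inner sum belonging to \<open>d\<close> has length \<open>N div d\<close>, so estimating it by its
  length costs a harmonic sum. Removing its mean part \<open>\<kappa> * (N div d)\<close> leaves
  something bounded uniformly in \<open>d\<close>, hence O(N) in total, and the removed parts add up
  to just \<open>\<kappa>\<close>. Rational slopes enter exactly here: they make the rounding error
  periodic. The totient is the same count for the slopes 0 and 1, so only the difference of two
  Moebius formulas has to be estimated. The coordinates \<open>s = y / x\<close>,
  \<open>u = 1 / x\<close> require \<open>x > 0\<close> and bounded slopes; this forces the cut into
  four sectors bounded by the diagonals. An auxiliary rational line beyond the set provides an
  outermost cell that the set does not meet, at which the sum of jumps starts from 0. Positive
  coefficients with \<open>k > 0\<close> require a nonempty combination; this is read off from the
  positive area of the polygon.\<close>

definition moebius :: "nat \<Rightarrow> int" where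
  "moebius n = (if squarefree n then (-1) ^ card (prime_factors n) else 0)"

lemma abs_moebius_le: "\<bar>moebius n\<bar> \<le> 1"
  by (simp add: moebius_def power_abs)

lemma moebius_prime_mult:
  assumes "prime p" "\<not> p dvd d" "d > 0"
  shows "moebius (p * d) = - moebius d"
proof -
  have cop: "coprime p d" using assms by (simp add: prime_imp_coprime)
  have sq: "squarefree (p * d) \<longleftrightarrow> squarefree d"
    using cop assms(1) squarefree_mult_coprime[of p d] squarefree_prime squarefree_mono[of d "p*d"] by auto
  have "prime_factors (p * d) = insert p (prime_factors d)"
    using assms by (subst prime_factors_product) (auto simp: prime_prime_factors)
  moreover have "p \<notin> prime_factors d" using assms by auto
  ultimately show ?thesis by (simp add: moebius_def sq)
qed

text \<open>The divisors \<open>d\<close> prime to a fixed prime \<open>p\<close> cancel against \<open>p d\<close>.\<close>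
lemma sum_moebius_divisors:
  fixes n :: nat
  assumes "n > 0"
  shows "(\<Sum>d | d dvd n. moebius d) = (if n = 1 then 1 else 0)"
proof (cases "n = 1")
  case True
  then show ?thesis by (simp add: moebius_def)
next
  case False
  then obtain p where p: "prime p" "p dvd n" using prime_factor_nat by blast
  \<comment> \<open>\<open>moebius\<close> vanishes off the squarefree divisors. Among the
    squarefree ones, multiplication by \<open>p\<close> is a bijection from those prime to
    \<open>p\<close> onto those divisible by \<open>p\<close>.\<close>
  define D where "D = {d. d dvd n \<and> squarefree d}"
  have finD: "finite D" using assms by (auto simp: D_def)
  have "(\<Sum>d | d dvd n. moebius d) = (\<Sum>d\<in>D. moebius d)"
    using assms by (intro sum.mono_neutral_right) (auto simp: D_def moebius_def)
  also have "\<dots> = (\<Sum>d\<in>{d\<in>D. \<not> p dvd d}. moebius d) + (\<Sum>d\<in>{d\<in>D. p dvd d}. moebius d)"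
    using finD by (subst sum.union_disjoint[symmetric]) (auto intro!: sum.cong)
  also have "(\<Sum>d\<in>{d\<in>D. p dvd d}. moebius d) = (\<Sum>d\<in>{d\<in>D. \<not> p dvd d}. - moebius d)"
  proof (rule sum.reindex_bij_witness[of _ "\<lambda>d. p * d" "\<lambda>d. d div p"])
    fix d assume "d \<in> {d \<in> D. p dvd d}"
    then obtain e where d: "d = p * e" "d dvd n" "squarefree d" by (auto simp: D_def)
    have p0: "p > 0" using p prime_gt_0_nat by blast
    have e: "d div p = e" using d p0 by simp
    have "\<not> p dvd e"
    proof
      assume "p dvd e"
      then have "p\<^sup>2 dvd d" using d by (auto simp: power2_eq_square)
      with d(3) p(1) show False unfolding squarefree_def by (metis not_prime_unit)
    qed
    moreover have "e dvd n" "squarefree e" using d squarefree_mono[of e d] by (auto dest: dvd_mult_right)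
    ultimately show "d div p \<in> {d \<in> D. \<not> p dvd d}" by (simp add: e D_def)
    show "p * (d div p) = d" using e d by simp
    have "e > 0" using d assms p0 by (metis \<open>\<not> p dvd e\<close> bot_nat_0.not_eq_extremum dvd_0_right)
    then show "- moebius (d div p) = moebius d"
      using moebius_prime_mult[OF p(1) \<open>\<not> p dvd e\<close>] e d by simp
  next
    fix d assume d: "d \<in> {d \<in> D. \<not> p dvd d}"
    have p0: "p > 0" using p prime_gt_0_nat by blast
    show "p * d div p = d" using p0 by simp
    have cop: "coprime p d" using d p by (simp add: prime_imp_coprime)
    then show "p * d \<in> {d \<in> D. p dvd d}"
      using d p by (auto simp: D_def intro: divides_mult squarefree_mult_coprime squarefree_prime)
  qed
  finally show ?thesis using False by (simp add: sum_negf)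
qed

text \<open>Writing \<open>j = d * e\<close>, both sides sum \<open>h d e\<close> over the pairs of
  positive numbers with \<open>d * e \<le> N\<close>.\<close>

lemma sum_divisors_hyperbola:
  fixes h :: "nat \<Rightarrow> nat \<Rightarrow> real"
  shows "(\<Sum>j=1..N. \<Sum>d | d dvd j. h d (j div d)) = (\<Sum>d=1..N. \<Sum>e=1..N div d. h d e)"
proof -
  have "(\<Sum>j=1..N. \<Sum>d | d dvd j. h d (j div d)) = (\<Sum>(j,d)\<in>(SIGMA j:{1..N}. {d. d dvd j}). h d (j div d))"
    by (rule sum.Sigma) auto
  also have "\<dots> = (\<Sum>(d,e)\<in>(SIGMA d:{1..N}. {1..N div d}). h d e)"
  proof (rule sum.reindex_bij_witness[of _ "\<lambda>(d,e). (d*e, d)" "\<lambda>(j,d). (d, j div d)"])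
    fix a assume "a \<in> (SIGMA j:{1..N}. {d. d dvd j})"
    then obtain d e where a: "a = (d * e, d)" "1 \<le> d * e" "d * e \<le> N" by (auto elim!: dvdE)
    then have de: "d > 0" "e > 0" by (auto simp: Suc_le_eq)
    have "d \<le> d * e" "e \<le> N div d"
      using de a(3) by (auto simp: less_eq_div_iff_mult_less_eq mult.commute)
    moreover from this have "d \<le> N" using a(3) by linarith
    ultimately show "(case a of (j, d) \<Rightarrow> (d, j div d)) \<in> (SIGMA d:{1..N}. {1..N div d})"
      using a de by auto
    show "(case case a of (j, d) \<Rightarrow> (d, j div d) of (d, e) \<Rightarrow> (d * e, d)) = a"
      and "(case case a of (j, d) \<Rightarrow> (d, j div d) of (d, e) \<Rightarrow> h d e) = (case a of (j, d) \<Rightarrow> h d (j div d))"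
      using a de by auto
  next
    fix b assume "b \<in> (SIGMA d:{1..N}. {1..N div d})"
    then obtain d e where b: "b = (d, e)" "d > 0" "e > 0" "e \<le> N div d" by auto
    then have "d * e \<le> N" by (simp add: less_eq_div_iff_mult_less_eq mult.commute)
    then show "(case b of (d, e) \<Rightarrow> (d * e, d)) \<in> (SIGMA j:{1..N}. {d. d dvd j})"
      using b by (auto simp: Suc_le_eq)
    show "(case case b of (d, e) \<Rightarrow> (d * e, d) of (j, d) \<Rightarrow> (d, j div d)) = b"
      using b by auto
  qed
  also have "\<dots> = (\<Sum>d=1..N. \<Sum>e=1..N div d. h d e)"
    by (rule sum.Sigma[symmetric]) auto
  finally show ?thesis .
qed

text \<open>\<open>N div d\<close> counts the \<open>e\<close> with \<open>d * e \<le> N\<close>.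
  Regrouping by \<open>j = d * e\<close> leaves full divisor sums of \<open>moebius\<close>, of
  which only the one for \<open>j = 1\<close> survives.\<close>

lemma sum_moebius_floor:
  assumes "N > 0"
  shows "(\<Sum>d=1..N. moebius d * int (N div d)) = 1"
proof -
  have "real_of_int (\<Sum>d=1..N. moebius d * int (N div d)) = (\<Sum>d=1..N. \<Sum>e=1..N div d. real_of_int (moebius d))"
    by (simp add: mult.commute)
  also have "\<dots> = (\<Sum>j=1..N. \<Sum>d | d dvd j. real_of_int (moebius d))"
    by (rule sum_divisors_hyperbola[symmetric])
  also have "\<dots> = (\<Sum>j=1..N. real_of_int (if j = 1 then 1 else 0))"
    by (intro sum.cong refl) (simp flip: of_int_sum add: sum_moebius_divisors)
  also have "\<dots> = (\<Sum>j=1..N. if j = 1 then 1 else 0)" by (intro sum.cong refl) auto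
  also have "\<dots> = 1" using assms by (subst sum.delta) auto
  finally show ?thesis by (metis of_int_1 of_int_eq_iff)
qed

text \<open>\<open>k\<close> runs through all integers, since slopes may be negative. The half-open
  interval makes the number of multiples of \<open>d\<close> in it an exact difference of floors,
  also when an endpoint is an integer.\<close>

definition coprime_count :: "real \<Rightarrow> real \<Rightarrow> nat \<Rightarrow> nat" where
  "coprime_count A B j = card {k::int. A * real j < of_int k \<and> of_int k \<le> B * real j \<and> gcd (int j) k = 1}"

text \<open>The condition on the gcd is expanded as the sum of \<open>moebius d\<close> over the
  common divisors. For \<open>j = d * e\<close> the multiples of \<open>d\<close> in the interval of
  \<open>j\<close> correspond to the integers in the interval of \<open>e\<close>, because the
  endpoints are linear in \<open>j\<close>.\<close>

lemma coprime_count_moebius: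
  assumes "A \<le> B" "j > 0"
  shows "real (coprime_count A B j) =
    (\<Sum>d | d dvd j. of_int (moebius d) * of_int (\<lfloor>B * real (j div d)\<rfloor> - \<lfloor>A * real (j div d)\<rfloor>))"
proof -
  define I where "I = {\<lfloor>A * real j\<rfloor><..\<lfloor>B * real j\<rfloor>}"
  have I: "k \<in> I \<longleftrightarrow> A * real j < of_int k \<and> of_int k \<le> B * real j" for k
    unfolding I_def by (simp add: le_floor_iff floor_less_iff)
  have finI: "finite I" by (simp add: I_def)
  have eq: "{k::int. A * real j < of_int k \<and> of_int k \<le> B * real j \<and> gcd (int j) k = 1} = {k\<in>I. gcd (int j) k = 1}"
    using I by auto
  have "int (coprime_count A B j) = (\<Sum>k\<in>I. if gcd (int j) k = 1 then 1 else 0)"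
    unfolding coprime_count_def eq using finI by (simp add: sum.If_cases Int_def)
  also have "\<dots> = (\<Sum>k\<in>I. \<Sum>d | d dvd j \<and> int d dvd k. moebius d)"
  proof (intro sum.cong refl)
    fix k assume "k \<in> I"
    have g: "nat (gcd (int j) k) > 0" using assms by (simp add: gcd_pos_int)
    have "{d. d dvd j \<and> int d dvd k} = {d. d dvd nat (gcd (int j) k)}"
      by (auto simp: nat_dvd_iff int_dvd_int_iff[symmetric] simp del: int_dvd_int_iff)
    then show "(if gcd (int j) k = 1 then 1 else 0) = (\<Sum>d | d dvd j \<and> int d dvd k. moebius d)"
      using sum_moebius_divisors[OF g] by (simp add: nat_eq_iff)
  qed
  also have "\<dots> = (\<Sum>k\<in>I. \<Sum>d | d dvd j. if int d dvd k then moebius d else 0)"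
    using assms by (intro sum.cong refl sum.mono_neutral_cong_left) auto
  also have "\<dots> = (\<Sum>d | d dvd j. \<Sum>k\<in>I. if int d dvd k then moebius d else 0)"
    by (rule sum.swap)
  also have "\<dots> = (\<Sum>d | d dvd j. moebius d * (\<lfloor>B * real (j div d)\<rfloor> - \<lfloor>A * real (j div d)\<rfloor>))"
  proof (intro sum.cong refl)
    fix d assume "d \<in> {d. d dvd j}"
    then obtain e where e: "j = d * e" by auto
    then have d0: "d > 0" using assms by auto
    have je: "j div d = e" using e d0 by simp
    have "(\<Sum>k\<in>I. if int d dvd k then moebius d else 0) = moebius d * int (card {k\<in>I. int d dvd k})"
      using finI by (simp add: sum.If_cases Int_def mult.commute)
    also have "card {k\<in>I. int d dvd k} = card {\<lfloor>A * real e\<rfloor><..\<lfloor>B * real e\<rfloor>}"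
    proof (rule bij_betw_same_card[OF bij_betw_byWitness[where f="\<lambda>k. k div int d" and f'="\<lambda>k. int d * k"]])
      have *: "int d * k \<in> I \<longleftrightarrow> k \<in> {\<lfloor>A * real e\<rfloor><..\<lfloor>B * real e\<rfloor>}" for k
      proof -
        have *: "A * real j = real d * (A * real e)" "B * real j = real d * (B * real e)"
          unfolding e by simp_all
        show ?thesis using d0 by (simp only: I * greaterThanAtMost_iff le_floor_iff floor_less_iff) simp
      qed
      show "(\<lambda>k. k div int d) ` {k\<in>I. int d dvd k} \<subseteq> {\<lfloor>A * real e\<rfloor><..\<lfloor>B * real e\<rfloor>}"
      proof
        fix k' assume "k' \<in> (\<lambda>k. k div int d) ` {k\<in>I. int d dvd k}"
        then obtain k where "int d * k \<in> I" "k' = int d * k div int d" by (auto elim!: dvdE)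
        then show "k' \<in> {\<lfloor>A * real e\<rfloor><..\<lfloor>B * real e\<rfloor>}" using *[of k] d0 by simp
      qed
      show "(\<lambda>k. int d * k) ` {\<lfloor>A * real e\<rfloor><..\<lfloor>B * real e\<rfloor>} \<subseteq> {k\<in>I. int d dvd k}"
        by (rule image_subsetI) (use * dvd_triv_left in blast)
    qed (use d0 in auto)
    also have "int \<dots> = \<lfloor>B * real e\<rfloor> - \<lfloor>A * real e\<rfloor>"
      using floor_mono[OF mult_right_mono[OF assms(1), of "real e"]] by simp
    finally show "(\<Sum>k\<in>I. if int d dvd k then moebius d else 0) =
        moebius d * (\<lfloor>B * real (j div d)\<rfloor> - \<lfloor>A * real (j div d)\<rfloor>)" by (simp add: je)
  qed
  finally have "int (coprime_count A B j) = \<dots>" .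
  then have "real_of_int (int (coprime_count A B j)) = real_of_int \<dots>" by (rule arg_cong)
  then show ?thesis by simp
qed

text \<open>This makes the comparison term of the main estimate another instance of
  \<open>coprime_count_moebius\<close>.\<close>

lemma coprime_count_0_1: "coprime_count 0 1 j = totient j"
proof -
  have "coprime_count 0 1 j = card (int ` totatives j)"
    unfolding coprime_count_def
  proof (intro arg_cong[of _ _ card] set_eqI iffI)
    fix k assume k: "k \<in> {k::int. 0 * real j < of_int k \<and> of_int k \<le> 1 * real j \<and> gcd (int j) k = 1}"
    then have "0 < k" "k \<le> int j" by auto
    moreover have "coprime (int (nat k)) (int j)"
      using k \<open>0 < k\<close> by (simp add: coprime_iff_gcd_eq_1 gcd.commute)
    then have "coprime (nat k) j" by (simp only: coprime_int_iff)
    ultimately have "nat k \<in> totatives j" "k = int (nat k)"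
      by (auto simp: in_totatives_iff)
    then show "k \<in> int ` totatives j" by blast
  next
    fix k assume "k \<in> int ` totatives j"
    then obtain m where m: "k = int m" "0 < m" "m \<le> j" "coprime m j" by (auto simp: in_totatives_iff)
    then have "gcd (int j) k = 1" by (metis coprime_iff_gcd_eq_1 gcd.commute coprime_int_iff)
    then show "k \<in> {k::int. 0 * real j < of_int k \<and> of_int k \<le> 1 * real j \<and> gcd (int j) k = 1}"
      using m by simp
  qed
  also have "\<dots> = totient j" by (simp add: card_image totient_def)
  finally show ?thesis .
qed

section \<open>Periodic rounding errors and their Moebius sums\<close>

text \<open>With \<open>\<kappa>\<close> the mean over one period, the deviation \<open>S M\<close>
  of the partial sum from \<open>\<kappa> * M\<close> is again periodic, as a full period
  contributes 0; hence it takes only finitely many values.\<close>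

lemma periodic_partial_sums_bound:
  fixes w :: "nat \<Rightarrow> real"
  assumes "Q > 0" and per: "\<And>n. w (n + Q) = w n"
  obtains \<kappa> C where "C \<ge> 0" "\<And>M. \<bar>(\<Sum>e=1..M. w e) - \<kappa> * real M\<bar> \<le> C"
proof -
  define \<kappa> where "\<kappa> = (\<Sum>e=1..Q. w e) / real Q"
  define S where "S M = (\<Sum>e=1..M. w e) - \<kappa> * real M" for M
  have S: "S (M + Q) = S M" for M
  proof (induction M)
    case 0 show ?case using assms(1) by (simp add: S_def \<kappa>_def)
  next
    case (Suc M) then show ?case using per[of "Suc M"] by (simp add: S_def algebra_simps)
  qed
  have S': "S (M + n * Q) = S M" for M n
  proof (induction n)
    case (Suc n)
    then show ?case using S[of "M + n * Q"] by (simp add: add.assoc add.commute[of Q])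
  qed simp
  have "\<bar>S M\<bar> \<le> (\<Sum>m<Q. \<bar>S m\<bar>)" for M
  proof -
    have "S M = S (M mod Q)" using S'[of "M mod Q" "M div Q"] by simp
    then show ?thesis using assms(1) member_le_sum[of "M mod Q" "{..<Q}" "\<lambda>m. \<bar>S m\<bar>"] by simp
  qed
  then show ?thesis using that[of "\<Sum>m<Q. \<bar>S m\<bar>" \<kappa>] by (auto simp: S_def sum_nonneg)
qed

text \<open>\<open>Q\<close> is a denominator of \<open>A\<close>: shifting \<open>n\<close> by
  \<open>Q\<close> moves \<open>A * n\<close> by an integer.\<close>

lemma floor_rat_mult_periodic:
  assumes "A \<in> \<rat>"
  obtains Q :: nat where "Q > 0" "\<And>n. \<lfloor>A * real (n + Q)\<rfloor> - A * real (n + Q) = \<lfloor>A * real n\<rfloor> - A * real n"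
proof -
  obtain a b where ab: "b > 0" "A = of_int a / of_int b"
    using assms Rats_cases' by metis
  have "A * real (n + nat b) = A * real n + of_int a" for n using ab by (simp add: field_simps)
  then show ?thesis using that[of "nat b"] ab(1) by simp
qed

lemma sum_coprime_count:
  assumes "A \<in> \<rat>" "B \<in> \<rat>" "A \<le> B"
  obtains C where "\<And>N. \<bar>(\<Sum>j=1..N. real (coprime_count A B j)) - (B - A) * (\<Sum>j=1..N. real (totient j))\<bar> \<le> C * real N"
proof -
  obtain Q1 :: nat where Q1: "Q1 > 0" "\<And>n. \<lfloor>A * real (n + Q1)\<rfloor> - A * real (n + Q1) = \<lfloor>A * real n\<rfloor> - A * real n"
    using floor_rat_mult_periodic[OF assms(1)] by blast
  obtain Q2 :: nat where Q2: "Q2 > 0" "\<And>n. \<lfloor>B * real (n + Q2)\<rfloor> - B * real (n + Q2) = \<lfloor>B * real n\<rfloor> - B * real n"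
    using floor_rat_mult_periodic[OF assms(2)] by blast
  define wA where "wA n = \<lfloor>A * real n\<rfloor> - A * real n" for n
  define wB where "wB n = \<lfloor>B * real n\<rfloor> - B * real n" for n
  have A: "wA (n + m * Q1) = wA n" for n m
  proof (induction m)
    case (Suc m)
    have "n + Suc m * Q1 = (n + m * Q1) + Q1" by simp
    then show ?case using Q1(2)[of "n + m * Q1"] Suc unfolding wA_def by presburger
  qed simp
  have B: "wB (n + m * Q2) = wB n" for n m
  proof (induction m)
    case (Suc m)
    have "n + Suc m * Q2 = (n + m * Q2) + Q2" by simp
    then show ?case using Q2(2)[of "n + m * Q2"] Suc unfolding wB_def by presburger
  qed simp
  \<comment> \<open>\<open>w e\<close> is the rounding error of the number of integers between
    \<open>A e\<close> and \<open>B e\<close> against the expected value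
    \<open>(B - A) * e\<close>.\<close>
  define w where "w n = wB n - wA n" for n
  have pos: "Q1 * Q2 > 0" using Q1(1) Q2(1) by simp
  have "w (n + Q1 * Q2) = w n" for n
    using A[of n Q2] B[of n Q1] by (simp add: w_def mult.commute)
  then obtain \<kappa> C where C: "C \<ge> 0" "\<And>M. \<bar>(\<Sum>e=1..M. w e) - \<kappa> * real M\<bar> \<le> C"
    using periodic_partial_sums_bound[of "Q1 * Q2" w] pos by blast
  have bound: "\<bar>(\<Sum>j=1..N. real (coprime_count A B j)) - (B - A) * (\<Sum>j=1..N. real (totient j))\<bar> \<le> (\<bar>\<kappa>\<bar> + C) * real N" for N
  proof (cases "N = 0")
    case False
    have "(\<Sum>j=1..N. real (coprime_count A B j)) - (B - A) * (\<Sum>j=1..N. real (totient j))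
        = (\<Sum>j=1..N. \<Sum>d | d dvd j. of_int (moebius d) * w (j div d))"
      unfolding sum_distrib_left sum_subtractf[symmetric]
    proof (intro sum.cong refl)
      fix j assume j: "j \<in> {1..N}"
      \<comment> \<open>For the slopes 0 and 1 the floor difference is \<open>j div d\<close>
        itself, so subtracting \<open>B - A\<close> times that formula turns every floor difference
        into a value of \<open>w\<close>.\<close>
      have "real (coprime_count A B j) - (B - A) * real (coprime_count 0 1 j) =
        (\<Sum>d | d dvd j. of_int (moebius d) * w (j div d))"
        using j assms(3)
        by (subst (1 2) coprime_count_moebius)
           (auto simp: sum_distrib_left sum_subtractf[symmetric] w_def wA_def wB_def algebra_simps intro!: sum.cong)
      then show "real (coprime_count A B j) - (B - A) * real (totient j) =
        (\<Sum>d | d dvd j. of_int (moebius d) * w (j div d))" by (simp add: coprime_count_0_1)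
    qed
    also have "\<dots> = (\<Sum>d=1..N. \<Sum>e=1..N div d. of_int (moebius d) * w e)"
      by (rule sum_divisors_hyperbola)
    \<comment> \<open>The mean is split off: the bracket is at most \<open>C\<close> in absolute
      value for every \<open>d\<close>, and the linear parts collapse to \<open>\<kappa>\<close> by
      \<open>sum_moebius_floor\<close>.\<close>
    also have "\<dots> = (\<Sum>d=1..N. of_int (moebius d) * ((\<Sum>e=1..N div d. w e) - \<kappa> * real (N div d)))
       + \<kappa> * of_int (\<Sum>d=1..N. moebius d * int (N div d))"
      by (simp add: sum_distrib_left sum.distrib[symmetric] algebra_simps)
    also have "\<dots> = (\<Sum>d=1..N. of_int (moebius d) * ((\<Sum>e=1..N div d. w e) - \<kappa> * real (N div d))) + \<kappa>"
      using False by (subst sum_moebius_floor) auto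
    also have "\<bar>\<dots>\<bar> \<le> (\<Sum>d=1..N. \<bar>of_int (moebius d) * ((\<Sum>e=1..N div d. w e) - \<kappa> * real (N div d))\<bar>) + \<bar>\<kappa>\<bar>"
      by (intro order_trans[OF abs_triangle_ineq] add_mono sum_abs order_refl)
    also have "\<dots> \<le> (\<Sum>d=1..N. 1 * C) + \<bar>\<kappa>\<bar> * real N"
    proof (intro add_mono sum_mono)
      show "\<bar>of_int (moebius d) * ((\<Sum>e=1..N div d. w e) - \<kappa> * real (N div d))\<bar> \<le> 1 * C" for d
        unfolding abs_mult using abs_moebius_le[of d] C by (intro mult_mono) auto
      show "\<bar>\<kappa>\<bar> \<le> \<bar>\<kappa>\<bar> * real N" using False by (simp add: mult_le_cancel_left1)
    qed
    also have "\<dots> = (\<bar>\<kappa>\<bar> + C) * real N" by (simp add: algebra_simps)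
    finally show ?thesis .
  qed auto
  then show ?thesis by (rule that)
qed

section \<open>Lattice triangles with a vertex at the origin\<close>

text \<open>In the coordinates \<open>j = p x + q y\<close>, \<open>k = r x + s y\<close> this is a
  triangle with apex at the origin, sides of slopes \<open>A\<close> and \<open>B\<close>, and far
  side \<open>j = f\<close>. The apex and the side of slope \<open>A\<close> are left out, so that
  each column \<open>j\<close> is exactly the interval of
  \<open>coprime_count A B j\<close>.\<close>

definition lattice_triangle :: "int \<Rightarrow> int \<Rightarrow> int \<Rightarrow> int \<Rightarrow> real \<Rightarrow> real \<Rightarrow> real \<Rightarrow> (real^2) set" where
  "lattice_triangle p q r s f A B =
     {v. 0 < of_int p * v$1 + of_int q * v$2 \<and> of_int p * v$1 + of_int q * v$2 \<le> f
       \<and> A * (of_int p * v$1 + of_int q * v$2) < of_int r * v$1 + of_int s * v$2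
       \<and> of_int r * v$1 + of_int s * v$2 \<le> B * (of_int p * v$1 + of_int q * v$2)}"

lemma scaleR_lattice_triangle:
  assumes "t > 0"
  shows "(*\<^sub>R) t ` lattice_triangle p q r s f A B = lattice_triangle p q r s (f * t) A B"
proof (intro set_eqI iffI)
  have *: "t *\<^sub>R v \<in> lattice_triangle p q r s (f * t) A B \<longleftrightarrow> v \<in> lattice_triangle p q r s f A B" for v
  proof -
    have 1: "of_int p * (t * v$1) + of_int q * (t * v$2) = t * (of_int p * v$1 + of_int q * v$2)"
      and 2: "of_int r * (t * v$1) + of_int s * (t * v$2) = t * (of_int r * v$1 + of_int s * v$2)"
      by (simp_all add: algebra_simps)
    show ?thesis
      using assms unfolding lattice_triangle_def mem_Collect_eq vector_scaleR_component real_scaleR_def 1 2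
      by (simp add: zero_less_mult_iff mult.left_commute[of _ t] mult.commute[of f])
  qed
  fix v
  show "v \<in> lattice_triangle p q r s (f * t) A B" if "v \<in> (*\<^sub>R) t ` lattice_triangle p q r s f A B"
    using that * by blast
  show "v \<in> (*\<^sub>R) t ` lattice_triangle p q r s f A B" if "v \<in> lattice_triangle p q r s (f * t) A B"
    using that *[of "(1/t) *\<^sub>R v"] assms by (auto intro!: image_eqI[of _ _ "(1/t) *\<^sub>R v"])
qed

section \<open>Unimodular coordinates and primitive points\<close>

lemma unimodular_solve:
  fixes p q r s x y :: "'a::comm_ring_1"
  assumes "(p * s - q * r) * (p * s - q * r) = 1"
  defines "e \<equiv> p * s - q * r"
  shows "e * (s * (p * x + q * y) - q * (r * x + s * y)) = x"
    and "e * (p * (r * x + s * y) - r * (p * x + q * y)) = y"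
    and "p * (e * (s * x - q * y)) + q * (e * (p * y - r * x)) = x"
    and "r * (e * (s * x - q * y)) + s * (e * (p * y - r * x)) = y"
proof -
  have e: "e * e = 1" unfolding e_def by (rule assms)
  have "e * (s * (p * x + q * y) - q * (r * x + s * y)) = e * e * x"
    "e * (p * (r * x + s * y) - r * (p * x + q * y)) = e * e * y"
    "p * (e * (s * x - q * y)) + q * (e * (p * y - r * x)) = e * e * x"
    "r * (e * (s * x - q * y)) + s * (e * (p * y - r * x)) = e * e * y"
    by (simp_all add: e_def algebra_simps)
  then show "e * (s * (p * x + q * y) - q * (r * x + s * y)) = x"
    and "e * (p * (r * x + s * y) - r * (p * x + q * y)) = y"
    and "p * (e * (s * x - q * y)) + q * (e * (p * y - r * x)) = x"
    and "r * (e * (s * x - q * y)) + s * (e * (p * y - r * x)) = y"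
    by (simp_all add: e)
qed

text \<open>The matrix and its inverse are both integral, so a pair and its image have the same
  common divisors.\<close>

lemma gcd_unimodular:
  fixes p q r s m n :: int
  assumes "(p * s - q * r) * (p * s - q * r) = 1"
  shows "gcd (p * m + q * n) (r * m + s * n) = 1 \<longleftrightarrow> gcd m n = 1"
proof -
  have "c dvd m \<and> c dvd n \<longleftrightarrow> c dvd p * m + q * n \<and> c dvd r * m + s * n" for c
    using unimodular_solve(1,2)[OF assms, of m n]
    by (metis dvd_add dvd_diff dvd_mult)
  then show ?thesis unfolding coprime_iff_gcd_eq_1[symmetric] coprime_def by metis
qed

text \<open>Primitive points are grouped by the integer \<open>j = p m + q n\<close>. The columns
  start at 1 because the apex is excluded; \<open>g\<close> is the inverse coordinate
  change.\<close>

lemma card_lattice_triangle: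
  assumes det: "(p * s - q * r) * (p * s - q * r) = 1"
  shows "card (lattice_triangle p q r s f A B \<inter> primitive_points) = (\<Sum>j=1..nat \<lfloor>f\<rfloor>. coprime_count A B j)"
proof -
  define e where "e = p * s - q * r"
  define X where "X = (SIGMA j:{1..nat \<lfloor>f\<rfloor>}. {k::int. A * real j < of_int k \<and> of_int k \<le> B * real j \<and> gcd (int j) k = 1})"
  define g :: "nat \<times> int \<Rightarrow> real^2" where
    "g = (\<lambda>(j,k). vector [of_int (e * (s * int j - q * k)), of_int (e * (p * k - r * int j))])"
  have fin: "finite {k::int. A * real j < of_int k \<and> of_int k \<le> B * real j \<and> gcd (int j) k = 1}" for j
  proof (rule finite_subset)
    show "{k::int. A * real j < of_int k \<and> of_int k \<le> B * real j \<and> gcd (int j) k = 1} \<subseteq> {\<lfloor>A * real j\<rfloor>..\<lfloor>B * real j\<rfloor>}"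
      by (auto simp: le_floor_iff) linarith
  qed simp
  have "(\<Sum>j=1..nat \<lfloor>f\<rfloor>. coprime_count A B j) = card X"
    unfolding X_def coprime_count_def by (rule card_SigmaI[symmetric]) (use fin in auto)
  also have "\<dots> = card (lattice_triangle p q r s f A B \<inter> primitive_points)"
  proof (rule bij_betw_same_card[of g])
    note sol = unimodular_solve[OF det, folded e_def]
    show "bij_betw g X (lattice_triangle p q r s f A B \<inter> primitive_points)"
      unfolding bij_betw_def
    proof
      show "inj_on g X"
      proof (rule inj_onI)
        fix x y assume "g x = g y"
        moreover obtain j k j' k' where xy: "x = (j,k)" "y = (j',k')" by (metis surj_pair)
        ultimately have "e * (s * int j - q * k) = e * (s * int j' - q * k')"
          "e * (p * k - r * int j) = e * (p * k' - r * int j')"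
          unfolding g_def by (simp_all only: case_prod_conv vec_eq_iff forall_2 vector_2 of_int_eq_iff)
        then have "p * (e * (s * int j - q * k)) + q * (e * (p * k - r * int j)) = p * (e * (s * int j' - q * k')) + q * (e * (p * k' - r * int j'))"
          "r * (e * (s * int j - q * k)) + s * (e * (p * k - r * int j)) = r * (e * (s * int j' - q * k')) + s * (e * (p * k' - r * int j'))"
          by (simp_all only:)
        then have "int j = int j'" "k = k'" unfolding sol(3,4) .
        then show "x = y" by (simp add: xy)
      qed
      show "g ` X = lattice_triangle p q r s f A B \<inter> primitive_points"
      proof (intro set_eqI iffI)
        fix v assume "v \<in> g ` X"
        then obtain j k where jk: "(j,k) \<in> X" "v = g (j,k)" by auto
        define m n where "m = e * (s * int j - q * k)" and "n = e * (p * k - r * int j)"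
        have v: "v = vector [of_int m, of_int n]" using jk by (simp add: g_def m_def n_def)
        have mn: "p * m + q * n = int j" "r * m + s * n = k" using sol(3,4)[of "int j" k] by (simp_all add: m_def n_def)
        have "gcd m n = 1" using gcd_unimodular[OF det, of m n] jk(1) by (simp add: mn X_def)
        moreover have "of_int p * of_int m + of_int q * of_int n = real j" "of_int r * of_int m + of_int s * of_int n = real_of_int k"
          unfolding of_int_mult[symmetric] of_int_add[symmetric] mn by simp_all
        then have "v \<in> lattice_triangle p q r s f A B"
          using jk(1) by (simp add: v lattice_triangle_def X_def le_nat_floor) linarith
        ultimately show "v \<in> lattice_triangle p q r s f A B \<inter> primitive_points"
          unfolding primitive_points_def v by (intro IntI CollectI exI[of _ m] exI[of _ n] conjI refl)
      next
        fix v assume v: "v \<in> lattice_triangle p q r s f A B \<inter> primitive_points"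
        then obtain m n where mn: "v = vector [of_int m, of_int n]" "gcd m n = 1"
          by (auto simp: primitive_points_def)
        define j k where "j = p * m + q * n" and "k = r * m + s * n"
        have jk: "of_int p * of_int m + of_int q * of_int n = real_of_int j" "of_int r * of_int m + of_int s * of_int n = real_of_int k"
          by (simp_all add: j_def k_def)
        from v have *: "0 < real_of_int j" "real_of_int j \<le> f" "A * real_of_int j < of_int k" "of_int k \<le> B * real_of_int j"
          by (simp_all add: mn lattice_triangle_def jk)
        then have j: "int (nat j) = j" "nat j \<le> nat \<lfloor>f\<rfloor>" "nat j > 0" "real (nat j) = of_int j" by (auto simp: le_floor_iff nat_mono)
        have "gcd j k = 1" unfolding j_def k_def using gcd_unimodular[OF det] mn(2) by simp
        then have "(nat j, k) \<in> X" using * j by (simp add: X_def)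
        moreover have "g (nat j, k) = v"
          using sol(1,2)[of m n, folded j_def k_def] by (simp only: g_def case_prod_conv j(1) mn(1))
        ultimately show "v \<in> g ` X" by force
      qed
    qed
  qed
  finally show ?thesis ..
qed

section \<open>Area and error term of a lattice triangle\<close>

lemma negligible_line:
  fixes a b c :: real
  assumes "a \<noteq> 0 \<or> b \<noteq> 0"
  shows "negligible {v::real^2. a * v$1 + b * v$2 = c}"
proof -
  have "{v::real^2. a * v$1 + b * v$2 = c} = {v. vector [a,b] \<bullet> v = c}"
    by (simp add: inner_vec_def sum_2)
  moreover have "(vector [a,b] :: real^2) \<noteq> 0" using assms by (auto simp: vec_eq_iff forall_2)
  ultimately show ?thesis using negligible_hyperplane by metis
qed

text \<open>The set lies in the closed triangle \<open>H\<close>, and what it lacks of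
  \<open>H\<close> lies on the line \<open>k = A * j\<close>. The far corners of \<open>H\<close>
  are the points with coordinates \<open>(f, A f)\<close> and \<open>(f, B f)\<close>, and a
  coordinate change of determinant 1 or -1 preserves area.\<close>

lemma lattice_triangle_measure:
  assumes det: "(p * s - q * r) * (p * s - q * r) = 1" and "f > 0" "A < B"
  shows "measure lebesgue (lattice_triangle p q r s f A B) = (B - A) * f\<^sup>2 / 2"
    and "lattice_triangle p q r s f A B \<in> lmeasurable"
    and "bounded (lattice_triangle p q r s f A B)"
proof -
  define P Q R S :: real where defs: "P = of_int p" "Q = of_int q" "R = of_int r" "S = of_int s"
  define e where "e = P * S - Q * R"
  have det': "(P * S - Q * R) * (P * S - Q * R) = 1"
    unfolding defs of_int_mult[symmetric] of_int_diff[symmetric] det by simp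
  have e1: "e * e = 1" using det' by (simp add: e_def)
  note sol = unimodular_solve[OF det', folded e_def]
  define w :: "real \<Rightarrow> real \<Rightarrow> real^2" where "w j k = vector [e * (S * j - Q * k), e * (P * k - R * j)]" for j k
  define H where "H = convex hull {0, w f (A * f), w f (B * f)}"
  let ?T = "lattice_triangle p q r s f A B"
  have sub: "?T \<subseteq> H"
  proof
    fix v assume v: "v \<in> ?T"
    define j k where "j = P * v$1 + Q * v$2" and "k = R * v$1 + S * v$2"
    have jk: "0 < j" "j \<le> f" "A * j < k" "k \<le> B * j" using v by (auto simp: lattice_triangle_def j_def k_def defs)
    \<comment> \<open>Barycentric weights of the two far corners, solved from
      \<open>x * f + y * f = j\<close> and \<open>x * (A * f) + y * (B * f) = k\<close>.\<close>
    define x y where "x = (B * j - k) / (f * (B - A))" and "y = (k - A * j) / (f * (B - A))"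
    have xy: "x \<ge> 0" "y \<ge> 0" using jk assms by (auto simp: x_def y_def)
    have nz: "f \<noteq> 0" "B - A \<noteq> 0" using assms by auto
    have sum: "x * f + y * f = j" "x * (A * f) + y * (B * f) = k"
      using nz by (simp_all add: x_def y_def divide_simps) (simp_all add: algebra_simps)
    have "(x + y) * f \<le> 1 * f" using sum jk by (simp add: algebra_simps)
    then have le: "x + y \<le> 1" using assms by simp
    have "v = (1 - x - y) *\<^sub>R 0 + x *\<^sub>R w f (A * f) + y *\<^sub>R w f (B * f)"
    proof -
      have "e * (S * j - Q * k) = x * (e * (S * f - Q * (A * f))) + y * (e * (S * f - Q * (B * f)))"
        "e * (P * k - R * j) = x * (e * (P * (A * f) - R * f)) + y * (e * (P * (B * f) - R * f))"
        unfolding sum[symmetric] by (simp_all add: algebra_simps)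
      then show ?thesis
        using sol(1,2)[of "v$1" "v$2"] by (simp add: vec_eq_iff forall_2 w_def j_def k_def)
    qed
    then show "v \<in> H" unfolding H_def convex_hull_3 using xy le
      by (intro CollectI exI[of _ "1 - x - y"] exI[of _ x] exI[of _ y]) auto
  qed
  have diff: "H - ?T \<subseteq> {v. (R - A * P) * v$1 + (S - A * Q) * v$2 = 0}"
  proof
    fix v assume v: "v \<in> H - ?T"
    then obtain u x y where uxy: "u \<ge> 0" "x \<ge> 0" "y \<ge> 0" "u + x + y = 1"
      "v = u *\<^sub>R 0 + x *\<^sub>R w f (A * f) + y *\<^sub>R w f (B * f)" unfolding H_def convex_hull_3 by auto
    define j k where "j = P * v$1 + Q * v$2" and "k = R * v$1 + S * v$2"
    have "v$1 = e * (S * (x * f + y * f) - Q * (x * (A * f) + y * (B * f)))"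
      "v$2 = e * (P * (x * (A * f) + y * (B * f)) - R * (x * f + y * f))"
      unfolding uxy by (simp_all add: w_def algebra_simps)
    then have jk: "j = x * f + y * f" "k = x * (A * f) + y * (B * f)"
      using sol(3,4)[of "x * f + y * f" "x * (A * f) + y * (B * f)"] by (simp_all add: j_def k_def)
    have 1: "0 \<le> j" using uxy assms by (simp add: jk)
    have "(x + y) * f \<le> 1 * f" using uxy assms by (intro mult_right_mono) auto
    then have 2: "j \<le> f" by (simp add: jk algebra_simps)
    have 3: "k - A * j = y * f * (B - A)" "B * j - k = x * f * (B - A)" by (simp_all add: jk algebra_simps)
    have 4: "0 \<le> y * f * (B - A)" "0 \<le> x * f * (B - A)" using uxy assms by auto
    have "k = A * j"
    proof (rule ccontr)
      assume "k \<noteq> A * j"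
      then have k: "A * j < k" "k \<le> B * j" using 3 4 by linarith+
      then have "j \<noteq> 0" by auto
      then have "v \<in> ?T" using 1 2 k by (simp add: lattice_triangle_def defs j_def k_def)
      then show False using v by blast
    qed
    then show "v \<in> {v. (R - A * P) * v$1 + (S - A * Q) * v$2 = 0}" by (simp add: j_def k_def algebra_simps)
  qed
  have "R - A * P \<noteq> 0 \<or> S - A * Q \<noteq> 0"
  proof (rule ccontr)
    assume "\<not> ?thesis"
    then have "R = A * P" "S = A * Q" by auto
    then have "e = 0" by (simp add: e_def)
    then show False using e1 by simp
  qed
  from negligible_subset[OF negligible_line[OF this] diff] have neg: "negligible (H - ?T)" .
  have H: "H \<in> lmeasurable" unfolding H_def
    by (intro lmeasurable_compact compact_convex_hull finite_imp_compact) auto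
  have T_eq: "?T = H - (H - ?T)" using sub by auto
  show "?T \<in> lmeasurable"
    by (subst T_eq) (rule fmeasurable.Diff[OF H negligible_imp_measurable[OF neg]])
  have "measure lebesgue ?T = measure lebesgue H"
    by (subst T_eq) (use H neg in \<open>simp add: measure_Diff_null_set negligible_iff_null_sets\<close>)
  also have "\<dots> = measure lborel H" using H by (simp add: measure_completion H_def compact_convex_hull borel_compact)
  also have "\<dots> = \<bar>(e * e) * (e * (B - A) * f\<^sup>2)\<bar> / 2"
    unfolding H_def content_triangle
    by (simp add: w_def e_def power2_eq_square algebra_simps)
  also have "\<dots> = (B - A) * f\<^sup>2 / 2"
  proof -
    have "\<bar>e\<bar> = 1" using e1 by (simp only: abs_square_eq_1[symmetric] power2_eq_square)
    then show ?thesis using assms by (simp add: e1 abs_mult)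
  qed
  finally show "measure lebesgue ?T = (B - A) * f\<^sup>2 / 2" .
  show "bounded ?T"
    using sub by (rule bounded_subset[rotated]) (simp add: H_def finite_imp_bounded bounded_convex_hull)
qed

text \<open>The quadratic terms agree because the area is \<open>(B - A) * f\<^sup>2 / 2\<close>.
  There remain the error of \<open>sum_coprime_count\<close> and the constant \<open>B - A\<close>
  produced by the summand 1 in \<open>E_Delta\<close>; both are O(t).\<close>

lemma E_lattice_triangle:
  assumes det: "(p * s - q * r) * (p * s - q * r) = 1" and "f > 0" "A \<in> \<rat>" "B \<in> \<rat>" "A < B"
  shows "(\<lambda>t. E_polygon (lattice_triangle p q r s f A B) t - (B - A) * E_Delta (f * t)) \<in> O[at_top](\<lambda>t. t)"
proof -
  obtain C where C: "\<And>N. \<bar>(\<Sum>j=1..N. real (coprime_count A B j)) - (B - A) * (\<Sum>j=1..N. real (totient j))\<bar> \<le> C * real N"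
    using sum_coprime_count[of A B] assms by (metis less_imp_le)
  have C0: "C \<ge> 0" using C[of 1] by linarith
  show ?thesis
  proof (rule bigoI, rule eventually_mono[OF eventually_ge_at_top[of 1]])
    fix t :: real assume t: "1 \<le> t"
    define N where "N = nat \<lfloor>f * t\<rfloor>"
    have ft: "0 < f * t" using t assms by simp
    have N: "real N \<le> f * t" using ft by (simp add: N_def)
    have "{m. 1 \<le> m \<and> real m \<le> f * t} = {1..N}"
      using ft by (auto simp: N_def le_nat_floor le_nat_iff le_floor_iff)
    then have "E_Delta (f * t) = (\<Sum>j=1..N. real (totient j)) - 3 / pi\<^sup>2 * (f * t)\<^sup>2 + 1"
      by (simp add: E_Delta_def)
    moreover have "E_polygon (lattice_triangle p q r s f A B) t
        = (\<Sum>j=1..N. real (coprime_count A B j)) - 6 / pi\<^sup>2 * t\<^sup>2 * ((B - A) * f\<^sup>2 / 2)"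
      using t assms unfolding E_polygon_def
      by (simp add: scaleR_lattice_triangle card_lattice_triangle[OF det] lattice_triangle_measure(1)[OF det] N_def)
    moreover have "6 / pi\<^sup>2 * t\<^sup>2 * ((B - A) * f\<^sup>2 / 2) = (B - A) * (3 / pi\<^sup>2 * (f * t)\<^sup>2)"
      by (simp add: power_mult_distrib)
    ultimately have "E_polygon (lattice_triangle p q r s f A B) t - (B - A) * E_Delta (f * t)
       = (\<Sum>j=1..N. real (coprime_count A B j)) - (B - A) * (\<Sum>j=1..N. real (totient j)) - (B - A)"
      by algebra
    also have "norm \<dots> \<le> C * real N + (B - A)"
      using C[of N] assms by (simp add: abs_le_iff)
    also have "\<dots> \<le> C * (f * t) + (B - A) * t"
      using N C0 t assms by (intro add_mono mult_left_mono) auto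
    also have "\<dots> = (C * f + (B - A)) * norm t" using t by (simp add: algebra_simps)
    finally show "norm (E_polygon (lattice_triangle p q r s f A B) t - (B - A) * E_Delta (f * t)) \<le> (C * f + (B - A)) * norm t" .
  qed
qed

section \<open>Decompositions up to finitely many lines\<close>

lemma lattice_points_interval:
  fixes X :: "real set"
  assumes "X \<subseteq> range of_int" "\<And>x. x \<in> X \<Longrightarrow> \<bar>x\<bar> \<le> r" "r \<ge> 0"
  shows "finite X" "real (card X) \<le> 2 * r + 1"
proof -
  have sub: "X \<subseteq> of_int ` {-\<lfloor>r\<rfloor>..\<lfloor>r\<rfloor>}"
  proof
    fix x assume x: "x \<in> X"
    then obtain m where m: "x = of_int m" using assms(1) by auto
    have "real_of_int m \<le> r" "real_of_int (-m) \<le> r" using assms(2)[OF x] by (auto simp: m)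
    then have "m \<le> \<lfloor>r\<rfloor>" "-m \<le> \<lfloor>r\<rfloor>" by (simp_all only: le_floor_iff)
    then show "x \<in> of_int ` {-\<lfloor>r\<rfloor>..\<lfloor>r\<rfloor>}" by (auto simp: m)
  qed
  then show "finite X" by (rule finite_subset) simp
  have "card X \<le> card (real_of_int ` {-\<lfloor>r\<rfloor>..\<lfloor>r\<rfloor>})" by (rule card_mono) (use sub in auto)
  also have "\<dots> \<le> card {-\<lfloor>r\<rfloor>..\<lfloor>r\<rfloor>}" by (rule card_image_le) simp
  also have "\<dots> = nat (2 * \<lfloor>r\<rfloor> + 1)" by simp
  finally have "int (card X) \<le> 2 * \<lfloor>r\<rfloor> + 1" using assms(3) by (simp add: le_nat_iff)
  then have "real_of_int (int (card X)) \<le> real_of_int (2 * \<lfloor>r\<rfloor> + 1)" by (simp only: of_int_le_iff)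
  then show "real (card X) \<le> 2 * r + 1" using of_int_floor_le[of r] by (simp del: of_int_floor_le)
qed

lemma primitive_points_coord: "v \<in> primitive_points \<Longrightarrow> v $ i \<in> range of_int"
  using exhaust_2[of i] by (auto simp: primitive_points_def)

lemma finite_primitive_points_ball:
  assumes "r \<ge> 0"
  shows "finite (primitive_points \<inter> cball 0 r)"
proof (rule finite_subset)
  let ?X = "range real_of_int \<inter> {-r..r}"
  have "finite ?X" by (rule lattice_points_interval(1)[of _ r]) (use assms in auto)
  then show "finite ((\<lambda>(x,y). vector [x,y] :: real^2) ` (?X \<times> ?X))" by simp
  show "primitive_points \<inter> cball 0 r \<subseteq> (\<lambda>(x,y). vector [x,y] :: real^2) ` (?X \<times> ?X)"
  proof
    fix v :: "real^2" assume v: "v \<in> primitive_points \<inter> cball 0 r"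
    have "v $ i \<in> ?X" for i
      using v primitive_points_coord[of v i] component_le_norm_cart[of v i] by (auto simp: abs_le_iff)
    then show "v \<in> (\<lambda>(x,y). vector [x,y] :: real^2) ` (?X \<times> ?X)"
      by (intro image_eqI[of _ _ "(v$1,v$2)"]) (simp_all add: vec_eq_iff forall_2)
  qed
qed

text \<open>One of the two coordinates is injective on the line, the second one if the line is
  vertical. It maps the points in question to integers of absolute value at most
  \<open>r\<close>.\<close>

lemma card_primitive_points_line:
  fixes a b c r :: real
  assumes "a \<noteq> 0 \<or> b \<noteq> 0" "r \<ge> 0"
  shows "real (card {v \<in> primitive_points \<inter> cball 0 r. a * v$1 + b * v$2 = c}) \<le> 2 * r + 1"
proof -
  let ?G = "{v \<in> primitive_points \<inter> cball 0 r. a * v$1 + b * v$2 = c}"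
  obtain i :: 2 where i: "inj_on (\<lambda>v. v $ i) ?G"
  proof (cases "b = 0")
    case True
    show ?thesis by (rule that[of 2]) (use True assms in \<open>auto simp: inj_on_def vec_eq_iff forall_2\<close>)
  next
    case False
    show ?thesis by (rule that[of 1]) (use False in \<open>auto simp: inj_on_def vec_eq_iff forall_2\<close>)
  qed
  have "real (card ?G) = real (card ((\<lambda>v. v $ i) ` ?G))" using i by (simp add: card_image)
  also have "\<dots> \<le> 2 * r + 1"
  proof (rule lattice_points_interval(2))
    show "(\<lambda>v. v $ i) ` ?G \<subseteq> range real_of_int" using primitive_points_coord by blast
    show "\<bar>x\<bar> \<le> r" if "x \<in> (\<lambda>v. v $ i) ` ?G" for x
      using that component_le_norm_cart[of _ i] by (fastforce intro: order_trans)
  qed fact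
  finally show ?thesis .
qed

text \<open>The count becomes a sum over a finite index set that does not depend on
  \<open>S\<close>, so the counts of several sets can be combined linearly.\<close>

lemma card_scaleR_Int_eq_sum:
  fixes S P :: "'a::real_normed_vector set"
  assumes "t > 0" "S \<subseteq> cball 0 R" "finite (P \<inter> cball 0 (R * t))"
  shows "real (card ((*\<^sub>R) t ` S \<inter> P)) = (\<Sum>p\<in>P \<inter> cball 0 (R * t). indicator S ((1/t) *\<^sub>R p))"
proof -
  have "(*\<^sub>R) t ` S \<inter> P = {p \<in> P \<inter> cball 0 (R * t). (1/t) *\<^sub>R p \<in> S}"
  proof (intro set_eqI iffI)
    fix p assume "p \<in> (*\<^sub>R) t ` S \<inter> P"
    then obtain q where q: "q \<in> S" "p = t *\<^sub>R q" "p \<in> P" by auto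
    have "norm q \<le> R" using q assms by auto
    then show "p \<in> {p \<in> P \<inter> cball 0 (R * t). (1/t) *\<^sub>R p \<in> S}" using q assms by (simp add: mult.commute)
  next
    fix p assume "p \<in> {p \<in> P \<inter> cball 0 (R * t). (1/t) *\<^sub>R p \<in> S}"
    then show "p \<in> (*\<^sub>R) t ` S \<inter> P" using assms(1) by (auto intro!: image_eqI[of _ _ "(1/t) *\<^sub>R p"])
  qed
  then show ?thesis using assms(3)
    by (simp add: indicator_def sum.If_cases Int_def of_bool_def)
qed

lemma measure_combination:
  fixes T :: "'i \<Rightarrow> (real^2) set" and c :: "'i \<Rightarrow> real" and L :: "(real \<times> real \<times> real) set"
  assumes "finite I" "S \<in> lmeasurable"
    and T: "\<And>i. i \<in> I \<Longrightarrow> T i \<in> lmeasurable"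
    and L: "finite L" "\<And>a b d. (a,b,d) \<in> L \<Longrightarrow> a \<noteq> 0 \<or> b \<noteq> 0"
    and eq: "\<And>v. (\<And>a b d. (a,b,d) \<in> L \<Longrightarrow> a * v$1 + b * v$2 \<noteq> d) \<Longrightarrow>
               indicator S v = (\<Sum>i\<in>I. c i * indicator (T i) v)"
  shows "measure lebesgue S = (\<Sum>i\<in>I. c i * measure lebesgue (T i))"
proof -
  define Z where "Z = (\<Union>(a,b,d)\<in>L. {v::real^2. a * v$1 + b * v$2 = d})"
  have negZ: "negligible Z" unfolding Z_def
    by (intro negligible_Union) (use L negligible_line in \<open>auto\<close>)
  have eqZ: "indicator S v = (\<Sum>i\<in>I. c i * indicator (T i) v)" if "v \<notin> Z" for v
    by (rule eq) (use that in \<open>force simp: Z_def\<close>)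
  have "measure lebesgue S = integral UNIV (indicator S)" using assms(2) by (rule lmeasure_integral_UNIV)
  also have "\<dots> = integral UNIV (\<lambda>v. \<Sum>i\<in>I. c i * indicator (T i) v)"
    by (rule integral_spike[OF negZ]) (use eqZ in auto)
  also have "\<dots> = (\<Sum>i\<in>I. integral UNIV (\<lambda>v. c i * indicator (T i) v))"
  proof (intro integral_sum integrable_on_mult_right)
    show "indicat_real (T i) integrable_on UNIV" if "i \<in> I" for i
      using T[OF that] lmeasurable_iff_indicator_has_integral by (metis integrable_on_def)
  qed fact
  also have "\<dots> = (\<Sum>i\<in>I. c i * measure lebesgue (T i))"
    using T by (intro sum.cong refl) (simp add: lmeasure_integral_UNIV)
  finally show ?thesis .
qed

text \<open>The areas satisfy the same linear relation, so the quadratic terms cancel. The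
  difference of the counts sums the defect of the indicator identity over primitive points in a ball
  of radius O(t). The defect is bounded and vanishes off the dilated lines, each of which carries
  O(t) of these points.\<close>

lemma E_polygon_combination:
  fixes T :: "'i \<Rightarrow> (real^2) set" and c :: "'i \<Rightarrow> real" and L :: "(real \<times> real \<times> real) set"
  assumes "finite I" "bounded S" "S \<in> lmeasurable"
    and T: "\<And>i. i \<in> I \<Longrightarrow> bounded (T i)" "\<And>i. i \<in> I \<Longrightarrow> T i \<in> lmeasurable"
    and L: "finite L" "\<And>a b d. (a,b,d) \<in> L \<Longrightarrow> a \<noteq> 0 \<or> b \<noteq> 0"
    and eq: "\<And>v. (\<And>a b d. (a,b,d) \<in> L \<Longrightarrow> a * v$1 + b * v$2 \<noteq> d) \<Longrightarrow>
               indicator S v = (\<Sum>i\<in>I. c i * indicator (T i) v)"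
  shows "(\<lambda>t. E_polygon S t - (\<Sum>i\<in>I. c i * E_polygon (T i) t)) \<in> O[at_top](\<lambda>t. t)"
proof -
  define Z where "Z = (\<Union>(a,b,d)\<in>L. {v::real^2. a * v$1 + b * v$2 = d})"
  have eqZ: "indicator S v = (\<Sum>i\<in>I. c i * indicator (T i) v)" if "v \<notin> Z" for v
    by (rule eq) (use that in \<open>force simp: Z_def\<close>)
  have meas: "measure lebesgue S = (\<Sum>i\<in>I. c i * measure lebesgue (T i))"
    by (rule measure_combination) (fact assms T L eq)+
  have "bounded (S \<union> (\<Union>i\<in>I. T i))" using assms(1,2) T by (auto intro!: bounded_UN)
  then obtain R where "R > 0" "\<forall>v\<in>S \<union> (\<Union>i\<in>I. T i). norm v \<le> R"
    unfolding bounded_pos by blast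
  then have R: "R > 0" "S \<union> (\<Union>i\<in>I. T i) \<subseteq> cball 0 R" by auto
  define M where "M = 1 + (\<Sum>i\<in>I. \<bar>c i\<bar>)"
  have M0: "M \<ge> 0" by (simp add: M_def sum_nonneg add_nonneg_nonneg)
  define D where "D v = indicator S v - (\<Sum>i\<in>I. c i * indicator (T i) v)" for v
  have D_le: "\<bar>D v\<bar> \<le> M" for v
  proof -
    have "\<bar>D v\<bar> \<le> \<bar>indicator S v\<bar> + (\<Sum>i\<in>I. \<bar>c i * indicator (T i) v\<bar>)"
      unfolding D_def by (intro order_trans[OF abs_triangle_ineq4] add_mono sum_abs order_refl)
    also have "\<dots> \<le> M" unfolding M_def
      by (intro add_mono sum_mono) (auto simp: indicator_def abs_mult)
    finally show ?thesis .
  qed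
  have main: "\<bar>E_polygon S t - (\<Sum>i\<in>I. c i * E_polygon (T i) t)\<bar> \<le> M * (real (card L) * (2 * R + 1)) * t" if t: "t \<ge> 1" for t
  proof -
    let ?G = "primitive_points \<inter> cball 0 (R * t)"
    have Rt: "R * t \<ge> 0" using R t by simp
    have finG: "finite ?G" by (rule finite_primitive_points_ball[OF Rt])
    have cnt: "real (card ((*\<^sub>R) t ` U \<inter> primitive_points)) = (\<Sum>p\<in>?G. indicator U ((1/t) *\<^sub>R p))"
      if "U \<subseteq> cball 0 R" for U
      by (rule card_scaleR_Int_eq_sum) (use that t finG in auto)
    have "E_polygon S t - (\<Sum>i\<in>I. c i * E_polygon (T i) t)
      = real (card ((*\<^sub>R) t ` S \<inter> primitive_points)) - (\<Sum>i\<in>I. c i * real (card ((*\<^sub>R) t ` T i \<inter> primitive_points)))"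
      unfolding E_polygon_def meas
      by (simp add: right_diff_distrib sum_subtractf sum_distrib_left mult.left_commute)
    also have "\<dots> = (\<Sum>p\<in>?G. D ((1/t) *\<^sub>R p))"
    proof -
      have "(\<Sum>i\<in>I. c i * real (card ((*\<^sub>R) t ` T i \<inter> primitive_points)))
         = (\<Sum>i\<in>I. \<Sum>p\<in>?G. c i * indicator (T i) ((1/t) *\<^sub>R p))"
        by (intro sum.cong refl, subst cnt) (use R in \<open>auto simp: sum_distrib_left\<close>)
      also have "\<dots> = (\<Sum>p\<in>?G. \<Sum>i\<in>I. c i * indicator (T i) ((1/t) *\<^sub>R p))" by (rule sum.swap)
      finally show ?thesis using R by (simp add: cnt D_def sum_subtractf)
    qed
    also have "\<dots> = (\<Sum>p\<in>{p\<in>?G. (1/t) *\<^sub>R p \<in> Z}. D ((1/t) *\<^sub>R p))"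
      using finG eqZ by (intro sum.mono_neutral_right) (auto simp: D_def)
    also have "\<bar>\<dots>\<bar> \<le> (\<Sum>p\<in>{p\<in>?G. (1/t) *\<^sub>R p \<in> Z}. M)"
      by (intro order_trans[OF sum_abs] sum_mono D_le)
    also have "\<dots> = M * real (card {p\<in>?G. (1/t) *\<^sub>R p \<in> Z})" by simp
    also have "real (card {p\<in>?G. (1/t) *\<^sub>R p \<in> Z}) \<le> real (card L) * (2 * (R * t) + 1)"
    proof -
      have "{p\<in>?G. (1/t) *\<^sub>R p \<in> Z} \<subseteq> (\<Union>(a,b,d)\<in>L. {v \<in> ?G. a * v$1 + b * v$2 = d * t})"
      proof
        fix p assume p: "p \<in> {p\<in>?G. (1/t) *\<^sub>R p \<in> Z}"
        then obtain a b d where abd: "(a,b,d) \<in> L" "a * (p$1 / t) + b * (p$2 / t) = d" by (auto simp: Z_def)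
        have "a * p$1 + b * p$2 = (a * (p$1 / t) + b * (p$2 / t)) * t" using t by (simp add: field_simps)
        then have "a * p$1 + b * p$2 = d * t" by (simp only: abd)
        then show "p \<in> (\<Union>(a,b,d)\<in>L. {v \<in> ?G. a * v$1 + b * v$2 = d * t})"
          using p abd(1) by (intro UN_I[of "(a,b,d)"]) auto
      qed
      then have "card {p\<in>?G. (1/t) *\<^sub>R p \<in> Z} \<le> card (\<Union>(a,b,d)\<in>L. {v \<in> ?G. a * v$1 + b * v$2 = d * t})"
      proof (rule card_mono[rotated])
        show "finite (\<Union>(a,b,d)\<in>L. {v \<in> ?G. a * v$1 + b * v$2 = d * t})"
          by (rule finite_subset[OF _ finG]) auto
      qed
      also have "\<dots> \<le> (\<Sum>(a,b,d)\<in>L. card {v \<in> ?G. a * v$1 + b * v$2 = d * t})"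
        using card_UN_le[OF L(1), of "\<lambda>(a,b,d). {v \<in> ?G. a * v$1 + b * v$2 = d * t}"] by (simp add: case_prod_unfold)
      finally have "real (card {p\<in>?G. (1/t) *\<^sub>R p \<in> Z}) \<le> (\<Sum>(a,b,d)\<in>L. real (card {v \<in> ?G. a * v$1 + b * v$2 = d * t}))"
        unfolding case_prod_unfold by (simp only: of_nat_sum[symmetric] of_nat_le_iff)
      also have "\<dots> \<le> (\<Sum>l\<in>L. 2 * (R * t) + 1)"
        by (intro sum_mono) (use L Rt card_primitive_points_line in \<open>auto\<close>)
      finally show ?thesis by simp
    qed
    also have "2 * (R * t) + 1 \<le> (2 * R + 1) * t" using t by (simp add: algebra_simps)
    finally show ?thesis using M0 by (simp add: mult_left_mono mult.assoc)
  qed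
  show ?thesis
    by (rule bigoI[of _ "M * (real (card L) * (2 * R + 1))"], rule eventually_mono[OF eventually_ge_at_top[of 1]])
       (use main in auto)
qed

section \<open>Arrangements of lines in a wedge\<close>

text \<open>Otherwise the root \<open>- a / b\<close> lies strictly between \<open>s\<close> and
  \<open>t\<close>, hence in the interval. The sign of the product computed below shows this without
  knowing which of \<open>s\<close> and \<open>t\<close> is larger.\<close>

lemma affine_same_sign:
  fixes a b s t :: real
  assumes "\<And>x. \<alpha> < x \<Longrightarrow> x < \<beta> \<Longrightarrow> a + b * x \<noteq> 0" "\<alpha> < s" "s < \<beta>" "\<alpha> < t" "t < \<beta>"
  shows "a + b * s < 0 \<longleftrightarrow> a + b * t < 0"
proof -
  have *: False if "a + b * s < 0" "\<not> a + b * t < 0" "\<alpha> < s" "s < \<beta>" "\<alpha> < t" "t < \<beta>" for s t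
  proof -
    have t: "a + b * t > 0" using that assms(1)[of t] by simp
    then have b: "b \<noteq> 0" using that by auto
    have "(s - - a / b) * (- a / b - t) = - ((a + b * s) * (a + b * t)) / b\<^sup>2"
      using b by (simp add: field_simps power2_eq_square)
    also have "\<dots> > 0" using that t b by (simp add: mult_neg_pos divide_neg_pos)
    finally have "s < - a / b \<and> - a / b < t \<or> - a / b < s \<and> t < - a / b"
      by (auto simp: zero_less_mult_iff)
    then have "\<alpha> < - a / b" "- a / b < \<beta>" using that by auto
    then show False using assms(1)[of "- a / b"] b by simp
  qed
  show ?thesis using *[of s t] *[of t s] assms by blast
qed

text \<open>A new maximum \<open>b\<close> leaves the lower sets of all smaller elements unchanged
  and contributes \<open>g (insert b A) - g A\<close>.\<close>

lemma sum_downset_telescope: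
  fixes g :: "'a::linorder set \<Rightarrow> real"
  assumes "finite D"
  shows "(\<Sum>w\<in>D. g {y\<in>D. y \<le> w} - g {y\<in>D. y < w}) = g D - g {}"
  using assms
proof (induction rule: finite_linorder_max_induct)
  case empty
  then show ?case by simp
next
  case (insert b A)
  have b: "{y\<in>insert b A. y \<le> b} = insert b A" "{y\<in>insert b A. y < b} = A" using insert by force+
  have A: "{y\<in>insert b A. y \<le> w} = {y\<in>A. y \<le> w}" "{y\<in>insert b A. y < w} = {y\<in>A. y < w}" if "w \<in> A" for w
    using insert(2) that by force+
  have "b \<notin> A" using insert(2) by blast
  have "(\<Sum>w\<in>insert b A. g {y\<in>insert b A. y \<le> w} - g {y\<in>insert b A. y < w})
     = (g (insert b A) - g A) + (\<Sum>w\<in>A. g {y\<in>insert b A. y \<le> w} - g {y\<in>insert b A. y < w})"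
    unfolding sum.insert[OF insert(1) \<open>b \<notin> A\<close>] b ..
  also have "(\<Sum>w\<in>A. g {y\<in>insert b A. y \<le> w} - g {y\<in>insert b A. y < w})
     = (\<Sum>w\<in>A. g {y\<in>A. y \<le> w} - g {y\<in>A. y < w})"
    by (intro sum.cong refl) (simp only: A)
  finally show ?case using insert.IH by simp
qed

text \<open>Supplies a level just past one line and before the next, when a point is pulled towards
  the origin.\<close>

lemma finite_gap_above:
  fixes w :: real
  assumes "finite X"
  obtains z where "w < z" "\<And>x. x \<in> X \<Longrightarrow> x \<le> w \<or> z < x"
proof -
  from assms have "\<exists>z>w. \<forall>x\<in>X. x \<le> w \<or> z < x"
  proof induction
    case empty
    show ?case by (intro exI[of _ "w + 1"]) simp
  next
    case (insert x X)
    then obtain z where z: "z > w" "\<forall>x\<in>X. x \<le> w \<or> z < x" by blast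
    show ?case
    proof (cases "x \<le> w")
      case False
      then show ?thesis using z by (intro exI[of _ "min z ((x + w) / 2)"]) (auto simp: min_less_iff_disj)
    qed (use z in auto)
  qed
  then show thesis using that by blast
qed

text \<open>In the coordinates \<open>s = y / x\<close>, \<open>u = 1 / x\<close> the line \<open>a x + b y = 1\<close> becomes
  the graph \<open>u = a + b s\<close>, and points close to the origin have large \<open>u\<close>.\<close>
lemma wedge_decomposition:
  fixes S :: "real \<Rightarrow> real \<Rightarrow> bool" and F :: "(real \<times> real) set"
  assumes "\<alpha> < \<beta>" "finite F" and \<delta>: "(\<delta>, 0) \<in> F" "\<delta> > 0"
    and cell: "\<And>x y x' y'. \<lbrakk>\<alpha> * x < y; y < \<beta> * x; \<alpha> * x' < y'; y' < \<beta> * x';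
        \<And>a b. (a,b) \<in> F \<Longrightarrow> (a * x + b * y < 1 \<longleftrightarrow> a * x' + b * y' < 1) \<and> a * x + b * y \<noteq> 1 \<and> a * x' + b * y' \<noteq> 1\<rbrakk>
        \<Longrightarrow> S x y \<Longrightarrow> S x' y'"
    and noncross: "\<And>a b a' b' s. \<lbrakk>(a,b) \<in> F; (a',b') \<in> F; (a,b) \<noteq> (a',b'); \<alpha> < s; s < \<beta>\<rbrakk> \<Longrightarrow> a + b * s \<noteq> a' + b' * s"
    and bd: "\<And>x y. S x y \<Longrightarrow> \<delta> * x < 1"
  obtains c :: "real \<times> real \<Rightarrow> real" and F' where "F' \<subseteq> F"
    "\<And>a b. (a,b) \<in> F' \<Longrightarrow> a + b * \<alpha> > 0 \<and> a + b * \<beta> > 0"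
    "\<And>l. c l \<in> \<rat>"
    "\<And>x y. \<lbrakk>\<alpha> * x < y; y < \<beta> * x; \<And>a b. (a,b) \<in> F \<Longrightarrow> a * x + b * y \<noteq> 1\<rbrakk> \<Longrightarrow>
       of_bool (S x y) = (\<Sum>(a,b)\<in>F'. c (a,b) * of_bool (a * x + b * y \<le> 1))"
    "(\<And>x y \<theta>. S x y \<Longrightarrow> 0 < \<theta> \<Longrightarrow> \<theta> \<le> 1 \<Longrightarrow> S (\<theta> * x) (\<theta> * y)) \<Longrightarrow> (\<And>l. l \<in> F' \<Longrightarrow> c l \<ge> 0)"
proof -
  define s0 where "s0 = (\<alpha> + \<beta>) / 2"
  have s0: "\<alpha> < s0" "s0 < \<beta>" using assms(1) by (auto simp: s0_def)
  define val where "val s l = fst l + snd l * s" for s :: real and l :: "real \<times> real"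
  \<comment> \<open>By \<open>noncross\<close> the order of the lines along the single ray of slope
    \<open>s0\<close> is their order along every ray of the open wedge.\<close>
  define v where "v = val s0"
  have val_less: "val s l < val s l' \<longleftrightarrow> v l < v l'" if "l \<in> F" "l' \<in> F" "\<alpha> < s" "s < \<beta>" for s l l'
  proof (cases "l = l'")
    case False
    then have "(fst l - fst l') + (snd l - snd l') * x \<noteq> 0" if "\<alpha> < x" "x < \<beta>" for x
      using noncross[of "fst l" "snd l" "fst l'" "snd l'" x] \<open>l \<in> F\<close> \<open>l' \<in> F\<close> that
      by (simp add: algebra_simps prod_eq_iff)
    from affine_same_sign[of \<alpha> \<beta> "fst l - fst l'" "snd l - snd l'", OF this \<open>\<alpha> < s\<close> \<open>s < \<beta>\<close> s0]
    show ?thesis by (simp add: v_def val_def algebra_simps)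
  qed simp
  have inj: "l = l'" if "l \<in> F" "l' \<in> F" "v l = v l'" for l l'
    using noncross[of "fst l" "snd l" "fst l'" "snd l'" s0] s0 that by (auto simp: v_def val_def)
  \<comment> \<open>These are the lines that are at most as far out as
    \<open>\<delta> * x = 1\<close>. For all other lines, every point of \<open>S\<close> in the
    wedge satisfies \<open>a * x + b * y < 1\<close>, so they do not separate points of
    \<open>S\<close>.\<close>
  define F' where "F' = {l \<in> F. \<delta> \<le> v l}"
  have F': "F' \<subseteq> F" "finite F'" using assms(2) by (auto simp: F'_def)
  have \<delta>F': "(\<delta>, 0) \<in> F'" "v (\<delta>, 0) = \<delta>" using \<delta> by (auto simp: F'_def v_def val_def)
  define V where "V = v ` F'"
  have line: "fst l * x + snd l * y < 1 \<longleftrightarrow> val (y / x) l < 1 / x"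
    "fst l * x + snd l * y = 1 \<longleftrightarrow> val (y / x) l = 1 / x" if "x > 0" for l x y
  proof -
    have "val (y / x) l = (fst l * x + snd l * y) / x" using that by (simp add: val_def add_divide_distrib)
    then show "fst l * x + snd l * y < 1 \<longleftrightarrow> val (y / x) l < 1 / x"
      "fst l * x + snd l * y = 1 \<longleftrightarrow> val (y / x) l = 1 / x"
      using that by (simp_all add: divide_less_cancel)
  qed
  define cone where "cone x y \<longleftrightarrow> \<alpha> * x < y \<and> y < \<beta> * x \<and> (\<forall>l\<in>F. fst l * x + snd l * y \<noteq> 1)" for x y
  have cone: "x > 0" "\<alpha> < y / x" "y / x < \<beta>" "\<And>l. l \<in> F \<Longrightarrow> val (y / x) l \<noteq> 1 / x" if "cone x y" for x y
  proof -
    have "0 < (\<beta> - \<alpha>) * x" using that by (simp add: cone_def algebra_simps)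
    then show x: "x > 0" using assms(1) by (simp add: zero_less_mult_iff)
    show "\<alpha> < y / x" "y / x < \<beta>" "\<And>l. l \<in> F \<Longrightarrow> val (y / x) l \<noteq> 1 / x"
      using that x by (auto simp: cone_def line(2)[OF x, symmetric] field_simps)
  qed
  \<comment> \<open>The lines that lie beyond the point as seen from the origin. Larger values of
    \<open>v\<close> are closer to the origin, so this is a lower set of \<open>V\<close>; as
    \<open>v\<close> is injective on \<open>F\<close>, it encodes the side of every line of
    \<open>F'\<close>.\<close>
  define D where "D x y = v ` {l\<in>F'. fst l * x + snd l * y < 1}" for x y
  have D_iff: "v l \<in> D x y \<longleftrightarrow> fst l * x + snd l * y < 1" if "l \<in> F'" for l x y
  proof
    assume "v l \<in> D x y"
    then obtain l' where l': "l' \<in> F'" "fst l' * x + snd l' * y < 1" "v l = v l'" unfolding D_def by blast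
    then have "l = l'" using inj that F' by blast
    then show "fst l * x + snd l * y < 1" using l' by simp
  qed (use that in \<open>auto simp: D_def\<close>)
  have D_down: "w' \<in> D x y" if dd: "cone x y" "w \<in> D x y" "w' \<in> V" "w' \<le> w" for x y w w'
  proof -
    obtain l l' where l: "l \<in> F'" "l' \<in> F'" "w = v l" "w' = v l'" using dd unfolding D_def V_def by blast
    have "val (y / x) l < 1 / x" using D_iff[OF l(1)] dd line(1)[OF cone(1)[OF dd(1)]] l by simp
    moreover have "val (y / x) l' \<le> val (y / x) l"
      using val_less[of l l' "y / x"] cone[OF dd(1)] l F' dd(4) by force
    ultimately show ?thesis using D_iff[OF l(2)] line(1)[OF cone(1)[OF dd(1)]] l by simp
  qed
  \<comment> \<open>The indicator of \<open>S\<close> as a function of the cell. The empty set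
    stands for the cell past \<open>\<delta> * x = 1\<close>, which \<open>S\<close> does not
    meet.\<close>
  define \<phi> where "\<phi> X \<longleftrightarrow> (\<exists>x y. cone x y \<and> D x y = X \<and> S x y)" for X
  have \<phi>_empty: "\<not> \<phi> {}"
    using bd D_iff[OF \<delta>F'(1)] by (fastforce simp: \<phi>_def)
  have S_iff: "S x y \<longleftrightarrow> \<phi> (D x y)" if c: "cone x y" for x y
  proof
    assume "\<phi> (D x y)"
    then obtain x' y' where p': "cone x' y'" "D x' y' = D x y" "S x' y'" by (auto simp: \<phi>_def)
    have \<delta>D: "\<delta> \<in> D x y" using bd[OF p'(3)] D_iff[OF \<delta>F'(1), of x' y'] p'(2) \<delta>F'(2) by simp
    have below: "fst l * x + snd l * y < 1" if "l \<in> F" "l \<notin> F'" "cone x y" "\<delta> \<in> D x y" for l x y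
    proof -
      have "v l < v (\<delta>, 0)" using that \<delta>F' by (auto simp: F'_def)
      then have "val (y / x) l < val (y / x) (\<delta>, 0)"
        using val_less[of l "(\<delta>, 0)" "y / x"] cone[OF that(3)] that(1) \<delta> by simp
      also have "\<dots> < 1 / x" unfolding line(1)[OF cone(1)[OF that(3)], symmetric]
        using D_iff[OF \<delta>F'(1), of x y] that(4) \<delta>F'(2) by simp
      finally show ?thesis using line(1)[OF cone(1)[OF that(3)]] by simp
    qed
    have "fst l * x' + snd l * y' < 1 \<longleftrightarrow> fst l * x + snd l * y < 1" if "l \<in> F" for l
      using below[of l x y] below[of l x' y'] D_iff[of l x y] D_iff[of l x' y'] that c p' \<delta>D by metis
    then show "S x y"
      using cell[of x' y' x y] p' c by (force simp: cone_def)
  qed (use c in \<open>auto simp: \<phi>_def\<close>)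
  \<comment> \<open>The lower sets with and without \<open>v l\<close> are the cells on the near and
    on the far side of \<open>l\<close>, so the jump is counted as near minus far.\<close>
  define c where "c l = of_bool (\<phi> {y\<in>V. y \<le> v l}) - (of_bool (\<phi> {y\<in>V. y < v l}) :: real)" for l
  show thesis
  proof (rule that[of F' c])
    show "F' \<subseteq> F" by fact
    show "c l \<in> \<rat>" for l by (simp add: c_def)
    show "a + b * \<alpha> > 0 \<and> a + b * \<beta> > 0" if "(a,b) \<in> F'" for a b
    proof (cases "b = 0")
      case True
      then show ?thesis using that \<delta> by (auto simp: F'_def v_def val_def)
    next
      case False
      \<comment> \<open>The order of the lines is known only in the open wedge. Since
        \<open>a + b * s\<close> is at least \<open>\<delta>\<close> there, it is still positive at
        the endpoints: step inwards by some \<open>k\<close> so small that \<open>b * k\<close> is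
        at most \<open>\<delta> / 2\<close> in absolute value.\<close>
      have ge: "\<delta> \<le> a + b * s" if "\<alpha> < s" "s < \<beta>" for s
      proof -
        have "v (\<delta>, 0) \<le> v (a, b)" using \<open>(a,b) \<in> F'\<close> \<delta>F' by (auto simp: F'_def)
        then have "val s (\<delta>, 0) \<le> val s (a, b)"
          using val_less[of "(a,b)" "(\<delta>,0)" s] that \<delta> F' \<open>(a,b) \<in> F'\<close> by force
        then show ?thesis by (simp add: val_def)
      qed
      define h where "h = \<delta> / (2 * \<bar>b\<bar>)"
      have h: "h > 0" "b * h \<le> \<delta> / 2" "- (b * h) \<le> \<delta> / 2"
        using False \<delta> by (auto simp: h_def abs_if)
      define k where "k = min h ((\<beta> - \<alpha>) / 2)"
      have "k > 0" using h assms(1) by (simp add: k_def)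
      moreover have "k \<le> h" "k \<le> (\<beta> - \<alpha>) / 2"
        unfolding k_def by (rule min.cobounded1, rule min.cobounded2)
      ultimately have k: "k > 0" "k \<le> h" "\<alpha> + k < \<beta>" "\<alpha> < \<beta> - k" using assms(1) by (auto simp: field_simps)
      have "\<bar>b * k\<bar> \<le> \<bar>b * h\<bar>" using k h unfolding abs_mult by (intro mult_left_mono) auto
      then have "\<bar>b * k\<bar> \<le> \<delta> / 2" using h by linarith
      moreover have "\<delta> \<le> a + b * \<alpha> + b * k" "\<delta> \<le> a + b * \<beta> - b * k"
        using ge[of "\<alpha> + k"] ge[of "\<beta> - k"] k by (auto simp: algebra_simps)
      ultimately show ?thesis using \<delta> unfolding abs_le_iff by linarith
    qed
    show "of_bool (S x y) = (\<Sum>(a,b)\<in>F'. c (a,b) * of_bool (a * x + b * y \<le> 1))"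
      if xy: "\<alpha> * x < y" "y < \<beta> * x" "\<And>a b. (a,b) \<in> F \<Longrightarrow> a * x + b * y \<noteq> 1" for x y
    proof -
      have cn: "cone x y" using xy by (auto simp: cone_def)
      define g :: "real set \<Rightarrow> real" where "g X = of_bool (\<phi> X)" for X
      have "(\<Sum>(a,b)\<in>F'. c (a,b) * of_bool (a * x + b * y \<le> 1)) = (\<Sum>l\<in>{l\<in>F'. fst l * x + snd l * y < 1}. c l)"
        using F' xy(3) by (intro sum.mono_neutral_cong_right) (auto simp: less_le)
      also have "\<dots> = (\<Sum>w\<in>D x y. g {y\<in>V. y \<le> w} - g {y\<in>V. y < w})"
      proof -
        have "inj_on v {l\<in>F'. fst l * x + snd l * y < 1}" by (rule inj_onI) (use inj F' in blast)
        then show ?thesis unfolding D_def by (simp add: sum.reindex c_def g_def)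
      qed
      also have "\<dots> = (\<Sum>w\<in>D x y. g {z\<in>D x y. z \<le> w} - g {z\<in>D x y. z < w})"
      proof (intro sum.cong refl)
        fix w assume w: "w \<in> D x y"
        have "D x y \<subseteq> V" by (auto simp: D_def V_def)
        then have "{z\<in>V. z \<le> w} = {z\<in>D x y. z \<le> w}" "{z\<in>V. z < w} = {z\<in>D x y. z < w}"
          using D_down[OF cn w] by auto
        then show "g {z\<in>V. z \<le> w} - g {z\<in>V. z < w} = g {z\<in>D x y. z \<le> w} - g {z\<in>D x y. z < w}" by simp
      qed
      also have "\<dots> = g (D x y) - g {}" by (rule sum_downset_telescope) (use F' in \<open>simp add: D_def\<close>)
      also have "\<dots> = of_bool (S x y)" using \<phi>_empty S_iff[OF cn] by (simp add: g_def)
      finally show ?thesis ..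
    qed
    show "c l \<ge> 0" if star: "\<And>x y \<theta>. S x y \<Longrightarrow> 0 < \<theta> \<Longrightarrow> \<theta> \<le> 1 \<Longrightarrow> S (\<theta> * x) (\<theta> * y)" and l: "l \<in> F'" for l
    proof -
      \<comment> \<open>A point of \<open>S\<close> in the cell on the far side of \<open>l\<close>
        is pulled along its ray across \<open>l\<close>, but not as far as the next line. The factor
        \<open>\<theta>\<close> is chosen so that the new point has
        \<open>u = 1 / (\<theta> * x) = z\<close>.\<close>
      have "\<phi> {y\<in>V. y \<le> v l}" if "\<phi> {y\<in>V. y < v l}"
      proof -
        from that obtain x y where p: "cone x y" "D x y = {y\<in>V. y < v l}" "S x y" by (auto simp: \<phi>_def)
        note cn = cone[OF p(1)]
        define s where "s = y / x"
        have "v l \<notin> D x y" using p by simp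
        then have u: "1 / x < val s l" using D_iff[OF l] line(1)[OF cn(1)] cn(4)[of l] l F' by (force simp: s_def)
        obtain z where z: "val s l < z" "\<And>t. t \<in> val s ` F \<Longrightarrow> t \<le> val s l \<or> z < t"
          using finite_gap_above[of "val s ` F" "val s l"] assms(2) by blast
        have z0: "z > 0" using u z(1) cn(1) by (meson less_trans zero_less_divide_1_iff)
        define \<theta> where "\<theta> = 1 / (x * z)"
        have "1 < x * z" using u z(1) cn(1) by (simp add: pos_divide_less_eq mult.commute) (metis less_trans u z(1) pos_divide_less_eq mult.commute)
        then have \<theta>: "0 < \<theta>" "\<theta> \<le> 1" by (auto simp: \<theta>_def)
        have S': "S (\<theta> * x) (\<theta> * y)" using star[OF p(3) \<theta>] .
        have lx: "\<theta> * x > 0" "1 / (\<theta> * x) = z" "\<theta> * y / (\<theta> * x) = s" using \<theta> cn(1) z0 by (auto simp: \<theta>_def s_def)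
        have vz: "val s l' < z \<longleftrightarrow> v l' \<le> v l" "val s l' \<noteq> z" if "l' \<in> F" for l'
          using z(1) z(2)[of "val s l'"] val_less[of l l' s] cn(2,3) l F' that by (force simp: s_def)+
        have "cone (\<theta> * x) (\<theta> * y)"
          unfolding cone_def
        proof (intro conjI ballI)
          show "\<alpha> * (\<theta> * x) < \<theta> * y" "\<theta> * y < \<beta> * (\<theta> * x)"
            using cn \<theta> by (simp_all add: field_simps)
          show "fst l' * (\<theta> * x) + snd l' * (\<theta> * y) \<noteq> 1" if "l' \<in> F" for l'
            using vz(2)[OF that] line(2)[OF lx(1), of l' "\<theta> * y"] lx by simp
        qed
        moreover have "D (\<theta> * x) (\<theta> * y) = {y\<in>V. y \<le> v l}"
        proof -
          have "fst l' * (\<theta> * x) + snd l' * (\<theta> * y) < 1 \<longleftrightarrow> v l' \<le> v l" if "l' \<in> F'" for l'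
            using vz(1)[of l'] line(1)[OF lx(1), of l' "\<theta> * y"] lx that F' by auto
          then show ?thesis unfolding D_def V_def by auto
        qed
        ultimately show ?thesis using S' by (auto simp: \<phi>_def)
      qed
      then show ?thesis by (auto simp: c_def)
    qed
  qed
qed

text \<open>Scaling by \<open>f\<close> gives the line \<open>a x + b y = 1\<close> coprime integer
  coefficients \<open>p\<close>, \<open>q\<close>, and it becomes \<open>j = f\<close>. A Bezout
  relation \<open>u p + v q = 1\<close> completes \<open>(p, q)\<close> by the row
  \<open>(-v, u)\<close> to determinant 1. The conditions on \<open>a + b * \<alpha>\<close> and
  \<open>a + b * \<beta>\<close> say that both bounding rays point into
  \<open>j > 0\<close>.\<close>

lemma wedge_as_lattice_triangle:
  fixes \<alpha> \<beta> a b :: real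
  assumes "\<alpha> \<in> \<rat>" "\<beta> \<in> \<rat>" "a \<in> \<rat>" "b \<in> \<rat>" "\<alpha> < \<beta>" "a + b * \<alpha> > 0" "a + b * \<beta> > 0"
  obtains p q r s :: int and f A B :: real where
    "p * s - q * r = 1" "f > 0" "A < B" "f \<in> \<rat>" "A \<in> \<rat>" "B \<in> \<rat>"
    "\<And>x y. (\<alpha> * x < y \<and> y \<le> \<beta> * x \<and> a * x + b * y \<le> 1) \<longleftrightarrow>
       (0 < of_int p * x + of_int q * y \<and> of_int p * x + of_int q * y \<le> f
        \<and> A * (of_int p * x + of_int q * y) < of_int r * x + of_int s * y
        \<and> of_int r * x + of_int s * y \<le> B * (of_int p * x + of_int q * y))"
proof -
  obtain a1 a2 :: int where a: "a2 > 0" "a = of_int a1 / of_int a2" using assms(3) Rats_cases' by metis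
  obtain b1 b2 :: int where b: "b2 > 0" "b = of_int b1 / of_int b2" using assms(4) Rats_cases' by metis
  define g where "g = gcd (a1 * b2) (b1 * a2)"
  have "a1 \<noteq> 0 \<or> b1 \<noteq> 0"
  proof (rule ccontr)
    assume "\<not> ?thesis"
    then have "a = 0" "b = 0" by (simp_all add: a(2) b(2))
    then show False using assms(6) by simp
  qed
  then have "a1 * b2 \<noteq> 0 \<or> b1 * a2 \<noteq> 0" using a(1) b(1) by simp
  then have g: "g > 0" unfolding g_def by (simp only: gcd_pos_int)
  have "gcd (a1 * b2) (b1 * a2) \<noteq> 0" using g unfolding g_def by linarith
  from gcd_coprime_exists[OF this, folded g_def]
  obtain p q where pq: "a1 * b2 = p * g" "b1 * a2 = q * g" "coprime p q" by blast
  have "gcd p q = 1" using pq(3) by simp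
  then obtain u v where uv: "u * p + v * q = 1" using bezout_int[of p q] by metis
  define f :: real where "f = of_int (a2 * b2) / of_int g"
  have f: "f > 0" "f \<in> \<rat>" using a(1) b(1) g by (auto simp: f_def intro!: Rats_divide Rats_mult)
  define P Q U V :: real where defs: "P = of_int p" "Q = of_int q" "U = of_int u" "V = of_int v"
  have rats: "P \<in> \<rat>" "Q \<in> \<rat>" "U \<in> \<rat>" "V \<in> \<rat>" by (auto simp: defs)
  have UV: "U * P + V * Q = 1" unfolding defs of_int_mult[symmetric] of_int_add[symmetric] uv by simp
  have fa: "f * a = P" "f * b = Q"
  proof -
    have "f * a = of_int (a1 * b2) / of_int g" using a b by (simp add: f_def field_simps)
    then show "f * a = P" using g by (simp add: pq(1) defs)
    have "f * b = of_int (b1 * a2) / of_int g" using a b by (simp add: f_def field_simps)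
    then show "f * b = Q" using g by (simp add: pq(2) defs)
  qed
  define D E where "D = P + \<alpha> * Q" and "E = P + \<beta> * Q"
  have "D = f * (a + b * \<alpha>)" "E = f * (a + b * \<beta>)" by (simp_all add: D_def E_def fa[symmetric] algebra_simps)
  then have D: "D > 0" "E > 0" using f assms by auto
  \<comment> \<open>The slopes of the rays in the new coordinates: the point
    \<open>(1, \<alpha>)\<close> has \<open>j = D\<close> and \<open>k = \<alpha> * U - V\<close>,
    and likewise for \<open>\<beta>\<close> and \<open>E\<close>.\<close>
  define A B where "A = (\<alpha> * U - V) / D" and "B = (\<beta> * U - V) / E"
  show thesis
  proof (rule that[of p u q "- v" f A B])
    show "p * u - q * - v = 1" using uv by (simp add: algebra_simps)
    show "f > 0" "f \<in> \<rat>" by fact+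
    show "A \<in> \<rat>" "B \<in> \<rat>" using rats assms
      by (auto simp: A_def B_def D_def E_def intro!: Rats_divide Rats_diff Rats_mult Rats_add)
    have "(\<beta> * U - V) * D - (\<alpha> * U - V) * E = (\<beta> - \<alpha>) * (U * P + V * Q)"
      by (simp add: D_def E_def algebra_simps)
    then have "(\<alpha> * U - V) * E < (\<beta> * U - V) * D" using assms(5) UV by simp
    then show "A < B" using D by (simp add: A_def B_def divide_simps mult.commute)
    fix x y :: real
    define j k where "j = P * x + Q * y" and "k = U * y - V * x"
    have 1: "A * j < k \<longleftrightarrow> \<alpha> * x < y"
    proof -
      have "D * k - (\<alpha> * U - V) * j = (U * P + V * Q) * (y - \<alpha> * x)"
        by (simp add: D_def j_def k_def algebra_simps)
      then have "D * k - (\<alpha> * U - V) * j = y - \<alpha> * x" using UV by simp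
      moreover have "A * j < k \<longleftrightarrow> (\<alpha> * U - V) * j < D * k" using D by (simp add: A_def divide_simps mult.commute)
      ultimately show ?thesis by linarith
    qed
    have 2: "k \<le> B * j \<longleftrightarrow> y \<le> \<beta> * x"
    proof -
      have "E * k - (\<beta> * U - V) * j = (U * P + V * Q) * (y - \<beta> * x)"
        by (simp add: E_def j_def k_def algebra_simps)
      then have "E * k - (\<beta> * U - V) * j = y - \<beta> * x" using UV by simp
      moreover have "k \<le> B * j \<longleftrightarrow> E * k \<le> (\<beta> * U - V) * j" using D by (simp add: B_def divide_simps mult.commute)
      ultimately show ?thesis by linarith
    qed
    have "j = f * (a * x + b * y)" by (simp add: j_def fa[symmetric] algebra_simps)
    then have 3: "j \<le> f \<longleftrightarrow> a * x + b * y \<le> 1" using f by simp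
    have 4: "0 < j" if "\<alpha> * x < y" "y \<le> \<beta> * x"
    proof -
      have "(\<beta> - \<alpha>) * j = (y - \<alpha> * x) * E + (\<beta> * x - y) * D" by (simp add: j_def D_def E_def algebra_simps)
      also have "\<dots> > 0" using that D by (simp add: add_pos_nonneg)
      finally show ?thesis using assms(5) by (simp add: zero_less_mult_iff)
    qed
    have "(\<alpha> * x < y \<and> y \<le> \<beta> * x \<and> a * x + b * y \<le> 1) \<longleftrightarrow> (0 < j \<and> j \<le> f \<and> A * j < k \<and> k \<le> B * j)"
      using 1 2 3 4 by blast
    moreover have "k = of_int (- v) * x + of_int u * y" by (simp add: k_def defs)
    ultimately show "(\<alpha> * x < y \<and> y \<le> \<beta> * x \<and> a * x + b * y \<le> 1) \<longleftrightarrow>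
       (0 < of_int p * x + of_int q * y \<and> of_int p * x + of_int q * y \<le> f
        \<and> A * (of_int p * x + of_int q * y) < of_int (- v) * x + of_int u * y
        \<and> of_int (- v) * x + of_int u * y \<le> B * (of_int p * x + of_int q * y))"
      by (simp only: j_def defs)
  qed
qed

section \<open>From wedges to a sector\<close>

text \<open>The slopes in \<open>K\<close> cut the sector into open wedges that contain no point of
  a line of \<open>L\<close> through the origin and no crossing of two other lines, as
  \<open>wedge_decomposition\<close> demands. A point of the sector off the cutting rays lies in
  exactly one wedge, so the decompositions can be added.\<close>

lemma sector_decomposition:
  fixes S :: "real \<Rightarrow> real \<Rightarrow> bool" and L :: "(real \<times> real \<times> real) set"
  assumes finL: "finite L"
    and rat: "\<And>a b d. (a,b,d) \<in> L \<Longrightarrow> a \<in> \<rat> \<and> b \<in> \<rat> \<and> d \<in> \<rat>"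
    and nondeg: "\<And>a b d. (a,b,d) \<in> L \<Longrightarrow> a \<noteq> 0 \<or> b \<noteq> 0"
    and cell: "\<And>x y x' y'. (\<And>a b d. (a,b,d) \<in> L \<Longrightarrow> 0 < (a * x + b * y - d) * (a * x' + b * y' - d)) \<Longrightarrow> S x y \<Longrightarrow> S x' y'"
    and bd: "\<And>x y. S x y \<Longrightarrow> x < R"
  obtains I :: "((real \<times> real) \<times> (real \<times> real)) set" and c :: "(real \<times> real) \<times> (real \<times> real) \<Rightarrow> real" and L' :: "(real \<times> real \<times> real) set" where
    "finite I" "finite L'" "\<And>a b d. (a,b,d) \<in> L' \<Longrightarrow> a \<noteq> 0 \<or> b \<noteq> 0"
    "\<And>\<alpha> \<beta> a b. ((\<alpha>,\<beta>),(a,b)) \<in> I \<Longrightarrow> \<alpha> \<in> \<rat> \<and> \<beta> \<in> \<rat> \<and> a \<in> \<rat> \<and> b \<in> \<rat> \<and> \<alpha> < \<beta> \<and> a + b * \<alpha> > 0 \<and> a + b * \<beta> > 0"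
    "\<And>i. c i \<in> \<rat>"
    "\<And>x y. (\<And>a b d. (a,b,d) \<in> L' \<Longrightarrow> a * x + b * y \<noteq> d) \<Longrightarrow>
      of_bool (\<bar>y\<bar> < x \<and> S x y) = (\<Sum>((\<alpha>,\<beta>),(a,b))\<in>I. c ((\<alpha>,\<beta>),(a,b)) * of_bool (\<alpha> * x < y \<and> y \<le> \<beta> * x \<and> a * x + b * y \<le> 1))"
    "(\<And>x y \<theta>. S x y \<Longrightarrow> 0 < \<theta> \<Longrightarrow> \<theta> \<le> 1 \<Longrightarrow> S (\<theta> * x) (\<theta> * y)) \<Longrightarrow> (\<And>i. i \<in> I \<Longrightarrow> c i \<ge> 0)"
proof -
  obtain n :: nat where n: "R \<le> real n" using real_arch_simple by blast
  \<comment> \<open>The auxiliary line is \<open>x = n + 1\<close>, beyond \<open>S\<close>; the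
    successor also takes care of \<open>n = 0\<close>.\<close>
  define \<delta> where "\<delta> = 1 / real (Suc n)"
  have \<delta>: "\<delta> > 0" "\<delta> \<in> \<rat>" by (auto simp: \<delta>_def intro!: Rats_divide)
  have bd': "\<delta> * x < 1" if "S x y" for x y using bd[OF that] n by (simp add: \<delta>_def)
  \<comment> \<open>Lines that miss the origin are normalised to right-hand side 1. A line through
    the origin is no graph \<open>u = a + b * s\<close>; it enters through its slope in
    \<open>K\<close>.\<close>
  define F where "F = insert (\<delta>, 0) ((\<lambda>(a,b,d). (a / d, b / d)) ` {(a,b,d)\<in>L. d \<noteq> 0})"
  have finF: "finite F" unfolding F_def using finL by (auto intro!: finite_imageI finite_subset[OF _ finL])
  have ratF: "a \<in> \<rat> \<and> b \<in> \<rat>" if "(a,b) \<in> F" for a b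
    using that rat \<delta> by (auto simp: F_def intro!: Rats_divide)
  have nzF: "a \<noteq> 0 \<or> b \<noteq> 0" if "(a,b) \<in> F" for a b
    using that nondeg \<delta> by (auto simp: F_def)
  \<comment> \<open>For \<open>b = 0\<close> or \<open>b = b'\<close> the quotient is 0 by the
    convention on division, which only adds the harmless cutting slope 0.\<close>
  define K where "K = {-1, 1} \<union> (\<lambda>(a,b,d). - a / b) ` L \<union> (\<lambda>((a,b),(a',b')). (a' - a) / (b - b')) ` (F \<times> F)"
  have finK: "finite K" using finL finF by (simp add: K_def)
  have ratK: "k \<in> \<rat>" if "k \<in> K" for k
    using that rat ratF by (auto simp: K_def intro!: Rats_divide Rats_diff)
  define G where "G = {(\<alpha>,\<beta>)\<in>K \<times> K. \<alpha> < \<beta> \<and> -1 \<le> \<alpha> \<and> \<beta> \<le> 1 \<and> (\<forall>k\<in>K. \<not> (\<alpha> < k \<and> k < \<beta>))}"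
  have finG: "finite G" unfolding G_def by (rule finite_subset[of _ "K \<times> K"]) (use finK in auto)
  define star where "star \<longleftrightarrow> (\<forall>x y \<theta>. S x y \<longrightarrow> 0 < \<theta> \<longrightarrow> \<theta> \<le> 1 \<longrightarrow> S (\<theta> * x) (\<theta> * y))"
  \<comment> \<open>The conclusion of \<open>wedge_decomposition\<close> as one predicate, so that
    lines and coefficients can be chosen for all wedges at once.\<close>
  define P where "P = (\<lambda>(\<alpha>,\<beta>) F' (c :: real \<times> real \<Rightarrow> real). F' \<subseteq> F
      \<and> (\<forall>(a,b)\<in>F'. a + b * \<alpha> > 0 \<and> a + b * \<beta> > 0) \<and> (\<forall>l. c l \<in> \<rat>)
      \<and> (\<forall>x y. \<alpha> * x < y \<longrightarrow> y < \<beta> * x \<longrightarrow> (\<forall>(a,b)\<in>F. a * x + b * y \<noteq> 1) \<longrightarrow>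
           of_bool (S x y) = (\<Sum>(a,b)\<in>F'. c (a,b) * of_bool (a * x + b * y \<le> 1)))
      \<and> (star \<longrightarrow> (\<forall>l\<in>F'. c l \<ge> 0)))"
  have ex: "\<exists>F' c. P g F' c" if g: "g \<in> G" for g
  proof -
    obtain \<alpha> \<beta> where ab: "g = (\<alpha>,\<beta>)" by (cases g)
    have gap: "\<alpha> < \<beta>" "\<And>k. k \<in> K \<Longrightarrow> \<alpha> < k \<Longrightarrow> k < \<beta> \<Longrightarrow> False" using g by (auto simp: ab G_def)
    have F1: "(\<delta>, 0) \<in> F" by (simp add: F_def)
    have cell': "S x' y'" if c: "\<alpha> * x < y" "y < \<beta> * x" "\<alpha> * x' < y'" "y' < \<beta> * x'"
        "\<And>a b. (a,b) \<in> F \<Longrightarrow> (a * x + b * y < 1 \<longleftrightarrow> a * x' + b * y' < 1) \<and> a * x + b * y \<noteq> 1 \<and> a * x' + b * y' \<noteq> 1"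
        "S x y" for x y x' y'
    proof (rule cell[OF _ c(6)])
      fix a b d assume l: "(a,b,d) \<in> L"
      have "0 < (\<beta> - \<alpha>) * x" "0 < (\<beta> - \<alpha>) * x'" using c by (auto simp: algebra_simps)
      then have x: "x > 0" "x' > 0" using gap(1) by (auto simp: zero_less_mult_iff)
      show "0 < (a * x + b * y - d) * (a * x' + b * y' - d)"
      proof (cases "d = 0")
        case True
        have nz: "a + b * z \<noteq> 0" if "\<alpha> < z" "z < \<beta>" for z
        proof
          assume z: "a + b * z = 0"
          then have "b \<noteq> 0" using nondeg[OF l] by auto
          then have "z = - a / b" using z by (simp add: field_simps)
          then have "z \<in> K" using l by (force simp: K_def)
          then show False using gap(2) that by blast
        qed
        have s: "\<alpha> < y / x" "y / x < \<beta>" "\<alpha> < y' / x'" "y' / x' < \<beta>"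
          using c x by (simp_all add: field_simps)
        have "(a + b * (y / x) < 0 \<longleftrightarrow> a + b * (y' / x') < 0)"
          by (rule affine_same_sign[OF nz s]) auto
        then have "0 < (a + b * (y / x)) * (a + b * (y' / x'))"
          using nz[OF s(1,2)] nz[OF s(3,4)] by (auto simp: zero_less_mult_iff)
        then have "0 < (x * x') * ((a + b * (y / x)) * (a + b * (y' / x')))"
          using x by simp
        also have "\<dots> = (x * (a + b * (y / x))) * (x' * (a + b * (y' / x')))" by simp
        also have "\<dots> = (a * x + b * y - d) * (a * x' + b * y' - d)"
          using x True by (simp add: distrib_left mult.commute)
        finally show ?thesis .
      next
        case False
        then have "(a / d, b / d) \<in> F" using l by (force simp: F_def)
        from c(5)[OF this] have "0 < (a / d * x + b / d * y - 1) * (a / d * x' + b / d * y' - 1)"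
          by (auto simp: zero_less_mult_iff)
        then have "0 < d\<^sup>2 * ((a / d * x + b / d * y - 1) * (a / d * x' + b / d * y' - 1))" using False by simp
        also have "\<dots> = (d * (a / d * x + b / d * y - 1)) * (d * (a / d * x' + b / d * y' - 1))"
          by (simp add: power2_eq_square)
        also have "\<dots> = (a * x + b * y - d) * (a * x' + b * y' - d)"
          using False by (simp add: right_diff_distrib distrib_left)
        finally show ?thesis .
      qed
    qed
    have noncross: "a + b * s \<noteq> a' + b' * s"
      if "(a,b) \<in> F" "(a',b') \<in> F" "(a,b) \<noteq> (a',b')" "\<alpha> < s" "s < \<beta>" for a b a' b' s
    proof
      assume e: "a + b * s = a' + b' * s"
      then have nz: "b - b' \<noteq> 0" using that(3) by auto
      have "s * (b - b') = a' - a" using e by (simp add: algebra_simps)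
      then have "s = (\<lambda>((a,b),(a',b')). (a' - a) / (b - b')) ((a,b),(a',b'))"
        using nz by (simp add: eq_divide_eq)
      then have "s \<in> (\<lambda>((a,b),(a',b')). (a' - a) / (b - b')) ` (F \<times> F)"
        by (rule image_eqI) (use that(1,2) in simp)
      then have "s \<in> K" unfolding K_def by (rule UnI2)
      then show False using gap(2) that by blast
    qed
    show ?thesis
    proof (rule wedge_decomposition[of \<alpha> \<beta> F \<delta> S, OF gap(1) finF F1 \<delta>(1) cell' noncross bd'])
      fix c :: "real \<times> real \<Rightarrow> real" and F'
      assume W: "F' \<subseteq> F"
        "\<And>a b. (a,b) \<in> F' \<Longrightarrow> a + b * \<alpha> > 0 \<and> a + b * \<beta> > 0"
        "\<And>l. c l \<in> \<rat>"
        "\<And>x y. \<lbrakk>\<alpha> * x < y; y < \<beta> * x; \<And>a b. (a,b) \<in> F \<Longrightarrow> a * x + b * y \<noteq> 1\<rbrakk> \<Longrightarrow>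
           of_bool (S x y) = (\<Sum>(a,b)\<in>F'. c (a,b) * of_bool (a * x + b * y \<le> 1))"
        "(\<And>x y \<theta>. S x y \<Longrightarrow> 0 < \<theta> \<Longrightarrow> \<theta> \<le> 1 \<Longrightarrow> S (\<theta> * x) (\<theta> * y)) \<Longrightarrow> (\<And>l. l \<in> F' \<Longrightarrow> c l \<ge> 0)"
      have "\<forall>l\<in>F'. c l \<ge> 0" if star using W(5) that unfolding star_def by blast
      moreover have "\<forall>x y. \<alpha> * x < y \<longrightarrow> y < \<beta> * x \<longrightarrow> (\<forall>(a,b)\<in>F. a * x + b * y \<noteq> 1) \<longrightarrow>
           of_bool (S x y) = (\<Sum>(a,b)\<in>F'. c (a,b) * of_bool (a * x + b * y \<le> 1))"
        using W(4) by blast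
      ultimately have "P g F' c" unfolding P_def ab prod.case using W(1-3) by blast
      then show ?thesis by blast
    qed assumption+
  qed
  then obtain F' where "\<forall>g\<in>G. \<exists>c. P g (F' g) c" by metis
  then obtain cc where P: "P g (F' g) (cc g)" if "g \<in> G" for g by metis
  define I where "I = Sigma G F'"
  define c where "c i = cc (fst i) (snd i)" for i
  have F'sub: "F' g \<subseteq> F" if "g \<in> G" for g using P[OF that] by (auto simp: P_def split: prod.splits)
  have F'fin: "finite (F' g)" if "g \<in> G" for g using F'sub[OF that] finF finite_subset by blast
  define L' :: "(real \<times> real \<times> real) set" where "L' = (\<lambda>(a,b). (a,b,1)) ` F \<union> (\<lambda>k. (-k,1,0)) ` K"
  \<comment> \<open>Rationality is claimed for every index, while the chosen coefficients are
    controlled only on \<open>I\<close>.\<close>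
  define c' where "c' i = (if i \<in> I then c i else 0)" for i
  show thesis
  proof (rule that[of I L' c'])
    show "finite I" unfolding I_def using finG F'fin by (rule finite_SigmaI)
    show "finite L'" using finF finK by (simp add: L'_def)
    show "a \<noteq> 0 \<or> b \<noteq> 0" if "(a,b,d) \<in> L'" for a b d using that nzF by (auto simp: L'_def)
    show "\<alpha> \<in> \<rat> \<and> \<beta> \<in> \<rat> \<and> a \<in> \<rat> \<and> b \<in> \<rat> \<and> \<alpha> < \<beta> \<and> a + b * \<alpha> > 0 \<and> a + b * \<beta> > 0"
      if "((\<alpha>,\<beta>),(a,b)) \<in> I" for \<alpha> \<beta> a b
    proof -
      have i: "(\<alpha>,\<beta>) \<in> G" "(a,b) \<in> F' (\<alpha>,\<beta>)" using that by (auto simp: I_def)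
      have "(a,b) \<in> F" using F'sub i by blast
      moreover have "a + b * \<alpha> > 0 \<and> a + b * \<beta> > 0" using P[OF i(1)] i(2) by (auto simp: P_def)
      ultimately show ?thesis using i(1) ratK ratF[of a b] by (auto simp: G_def)
    qed
    show "c' i \<in> \<rat>" for i
      using P by (auto simp: c'_def c_def I_def P_def split: prod.splits)
    show "c' i \<ge> 0" if st: "\<And>x y \<theta>. S x y \<Longrightarrow> 0 < \<theta> \<Longrightarrow> \<theta> \<le> 1 \<Longrightarrow> S (\<theta> * x) (\<theta> * y)" and i: "i \<in> I" for i
    proof -
      have "star" using st by (simp add: star_def)
      then show ?thesis using P[of "fst i"] i by (auto simp: c'_def c_def I_def P_def split: prod.splits)
    qed
    fix x y assume off: "\<And>a b d. (a,b,d) \<in> L' \<Longrightarrow> a * x + b * y \<noteq> d"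
    have offF: "a * x + b * y \<noteq> 1" if "(a,b) \<in> F" for a b
      by (rule off) (use that in \<open>force simp: L'_def\<close>)
    have offK: "y \<noteq> k * x" if "k \<in> K" for k
      using off[of "-k" 1 0] that by (auto simp: L'_def)
    have "(\<Sum>((\<alpha>,\<beta>),(a,b))\<in>I. c' ((\<alpha>,\<beta>),(a,b)) * of_bool (\<alpha> * x < y \<and> y \<le> \<beta> * x \<and> a * x + b * y \<le> 1))
       = (\<Sum>((\<alpha>,\<beta>),(a,b))\<in>I. cc (\<alpha>,\<beta>) (a,b) * of_bool (\<alpha> * x < y \<and> y \<le> \<beta> * x \<and> a * x + b * y \<le> 1))"
      by (intro sum.cong refl) (auto simp: c'_def c_def)
    also have "\<dots> = (\<Sum>(\<alpha>,\<beta>)\<in>G. \<Sum>(a,b)\<in>F' (\<alpha>,\<beta>). cc (\<alpha>,\<beta>) (a,b) * of_bool (\<alpha> * x < y \<and> y \<le> \<beta> * x \<and> a * x + b * y \<le> 1))"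
      unfolding I_def using finG F'fin
      by (subst sum.Sigma[symmetric]) (auto simp: case_prod_unfold)
    also have "\<dots> = of_bool (\<bar>y\<bar> < x \<and> S x y)"
    proof (cases "\<bar>y\<bar> < x")
      case False
      have out: "\<not> (\<alpha> * x < y \<and> y \<le> \<beta> * x)" if "(\<alpha>,\<beta>) \<in> G" for \<alpha> \<beta>
      proof
        assume w: "\<alpha> * x < y \<and> y \<le> \<beta> * x"
        have g: "\<alpha> < \<beta>" "-1 \<le> \<alpha>" "\<beta> \<le> 1" "1 \<in> K" using that by (auto simp: G_def K_def)
        have "0 < (\<beta> - \<alpha>) * x" using w by (auto simp: algebra_simps)
        then have x: "x > 0" using g(1) by (auto simp: zero_less_mult_iff)
        have "-1 * x \<le> \<alpha> * x" "\<beta> * x \<le> 1 * x" using x g by (intro mult_right_mono; simp)+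
        then have "-x < y" "y \<le> x" using w by linarith+
        then show False using False offK[OF g(4)] by auto
      qed
      have "(\<Sum>(a,b)\<in>F' (\<alpha>,\<beta>). cc (\<alpha>,\<beta>) (a,b) * of_bool (\<alpha> * x < y \<and> y \<le> \<beta> * x \<and> a * x + b * y \<le> 1)) = 0"
        if "(\<alpha>,\<beta>) \<in> G" for \<alpha> \<beta>
        using out[OF that] by (intro sum.neutral) auto
      then have "(\<Sum>(\<alpha>,\<beta>)\<in>G. \<Sum>(a,b)\<in>F' (\<alpha>,\<beta>). cc (\<alpha>,\<beta>) (a,b) * of_bool (\<alpha> * x < y \<and> y \<le> \<beta> * x \<and> a * x + b * y \<le> 1)) = 0"
        by (intro sum.neutral) (auto simp only: split: prod.splits)
      then show ?thesis using False by simp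
    next
      case True
      then have x: "x > 0" by simp
      define s where "s = y / x"
      have s: "-1 < s" "s < 1" using True x by (auto simp: s_def field_simps abs_less_iff)
      have sK: "s \<notin> K" using offK[of s] x by (auto simp: s_def)
      \<comment> \<open>The wedge of the point lies between the cutting slopes adjacent to
        \<open>s\<close>; they exist because -1 and 1 belong to \<open>K\<close>.\<close>
      define \<alpha> where "\<alpha> = Max {k\<in>K. k < s}"
      define \<beta> where "\<beta> = Min {k\<in>K. s < k}"
      have ne: "-1 \<in> {k\<in>K. k < s}" "1 \<in> {k\<in>K. s < k}" using s by (auto simp: K_def)
      have fin: "finite {k\<in>K. k < s}" "finite {k\<in>K. s < k}" using finK by auto
      have \<alpha>: "\<alpha> \<in> K" "\<alpha> < s" "-1 \<le> \<alpha>" "\<And>k. k \<in> K \<Longrightarrow> k < s \<Longrightarrow> k \<le> \<alpha>"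
        using Max_in[OF fin(1)] Max_ge[OF fin(1)] ne(1) unfolding \<alpha>_def by auto
      have \<beta>: "\<beta> \<in> K" "s < \<beta>" "\<beta> \<le> 1" "\<And>k. k \<in> K \<Longrightarrow> s < k \<Longrightarrow> \<beta> \<le> k"
        using Min_in[OF fin(2)] Min_le[OF fin(2)] ne(2) unfolding \<beta>_def by auto
      have between: "k < s \<or> s < k" if "k \<in> K" for k using that sK by (metis linorder_neqE)
      have g: "(\<alpha>,\<beta>) \<in> G"
      proof -
        have "\<not> (\<alpha> < k \<and> k < \<beta>)" if "k \<in> K" for k
          using between[OF that]
        proof
          assume "k < s"
          then show ?thesis using \<alpha>(4)[OF that] by auto
        next
          assume "s < k"
          then show ?thesis using \<beta>(4)[OF that] by auto
        qed
        moreover have "\<alpha> < \<beta>" using \<alpha>(2) \<beta>(2) by simp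
        ultimately show ?thesis unfolding G_def using \<alpha>(1,3) \<beta>(1,3) by blast
      qed
      have w: "\<alpha> * x < y" "y < \<beta> * x" using \<alpha>(2) \<beta>(2) x by (simp_all add: s_def field_simps)
      define T where "T h = (\<Sum>(a,b)\<in>F' h. cc h (a,b) * of_bool (fst h * x < y \<and> y \<le> snd h * x \<and> a * x + b * y \<le> 1))" for h
      have T0: "T h = 0"
        if h: "h \<in> G - {(\<alpha>,\<beta>)}" for h
      proof -
        obtain \<alpha>' \<beta>' where h': "h = (\<alpha>',\<beta>')" by (cases h)
        have K': "\<alpha>' \<in> K" "\<beta>' \<in> K" "\<alpha>' < \<beta>'" "\<And>k. k \<in> K \<Longrightarrow> \<alpha>' < k \<Longrightarrow> k < \<beta>' \<Longrightarrow> False" using h by (auto simp: h' G_def)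
        have "\<not> (\<alpha>' * x < y \<and> y \<le> \<beta>' * x)"
        proof
          assume "\<alpha>' * x < y \<and> y \<le> \<beta>' * x"
          then have "\<alpha>' < s" "s \<le> \<beta>'" using x by (simp_all add: s_def field_simps)
          moreover have "s < \<beta>'" using between[OF K'(2)] \<open>s \<le> \<beta>'\<close> by simp
          ultimately have "\<alpha>' \<le> \<alpha>" "\<beta> \<le> \<beta>'" using \<alpha>(4)[OF K'(1)] \<beta>(4)[OF K'(2)] by blast+
          moreover have "\<not> \<alpha>' < \<alpha>" using K'(4)[OF \<alpha>(1)] \<alpha>(2) \<open>s \<le> \<beta>'\<close> by auto
          moreover have "\<not> \<beta> < \<beta>'" using K'(4)[OF \<beta>(1)] \<beta>(2) \<open>\<alpha>' < s\<close> by auto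
          ultimately show False using h by (simp add: h')
        qed
        then show ?thesis unfolding T_def by (auto simp: h' intro!: sum.neutral)
      qed
      have "(\<Sum>(\<alpha>,\<beta>)\<in>G. \<Sum>(a,b)\<in>F' (\<alpha>,\<beta>). cc (\<alpha>,\<beta>) (a,b) * of_bool (\<alpha> * x < y \<and> y \<le> \<beta> * x \<and> a * x + b * y \<le> 1))
        = (\<Sum>h\<in>G. T h)"
        by (simp add: T_def case_prod_unfold)
      also have "\<dots> = (\<Sum>h\<in>{(\<alpha>,\<beta>)}. T h)"
        by (rule sum.mono_neutral_right[OF finG]) (use g T0 in auto)
      also have "\<dots> = (\<Sum>(a,b)\<in>F' (\<alpha>,\<beta>). cc (\<alpha>,\<beta>) (a,b) * of_bool (a * x + b * y \<le> 1))"
        using w by (simp add: T_def)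
      also have "\<dots> = of_bool (S x y)"
      proof -
        have "\<forall>(a,b)\<in>F. a * x + b * y \<noteq> 1" using offF by auto
        then have "of_bool (S x y) = (\<Sum>(a,b)\<in>F' (\<alpha>,\<beta>). cc (\<alpha>,\<beta>) (a,b) * of_bool (a * x + b * y \<le> 1))"
          using P[OF g] w unfolding P_def prod.case by blast
        then show ?thesis ..
      qed
      finally show ?thesis using True by simp
    qed
    finally show "of_bool (\<bar>y\<bar> < x \<and> S x y) = (\<Sum>((\<alpha>,\<beta>),(a,b))\<in>I. c' ((\<alpha>,\<beta>),(a,b)) * of_bool (\<alpha> * x < y \<and> y \<le> \<beta> * x \<and> a * x + b * y \<le> 1))" ..
  qed
qed

section \<open>Combinations of error terms\<close>

text \<open>The number \<open>m\<close> is twice the area of the set: it shows that the combination belonging to a set of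
  positive measure is not empty.\<close>
definition E_Delta_combination :: "bool \<Rightarrow> (real \<Rightarrow> real) \<Rightarrow> real \<Rightarrow> bool" where
  "E_Delta_combination pos g m \<longleftrightarrow> (\<exists>xs::(rat \<times> rat) list.
     (\<forall>(r,f)\<in>set xs. f > 0 \<and> (pos \<longrightarrow> r > 0)) \<and>
     m = (\<Sum>(r,f)\<leftarrow>xs. of_rat r * (of_rat f)\<^sup>2) \<and>
     (\<lambda>t. g t - (\<Sum>(r,f)\<leftarrow>xs. of_rat r * E_Delta (of_rat f * t))) \<in> O[at_top](\<lambda>t. t))"

lemma E_Delta_combination_add:
  assumes "E_Delta_combination pos g m" "E_Delta_combination pos h n"
  shows "E_Delta_combination pos (\<lambda>t. g t + h t) (m + n)"
proof -
  obtain xs :: "(rat \<times> rat) list" where xs: "\<forall>(r,f)\<in>set xs. f > 0 \<and> (pos \<longrightarrow> r > 0)"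
     "m = (\<Sum>(r,f)\<leftarrow>xs. of_rat r * (of_rat f)\<^sup>2)"
     "(\<lambda>t. g t - (\<Sum>(r,f)\<leftarrow>xs. of_rat r * E_Delta (of_rat f * t))) \<in> O[at_top](\<lambda>t. t)"
    using assms(1) unfolding E_Delta_combination_def by blast
  obtain ys :: "(rat \<times> rat) list" where ys: "\<forall>(r,f)\<in>set ys. f > 0 \<and> (pos \<longrightarrow> r > 0)"
     "n = (\<Sum>(r,f)\<leftarrow>ys. of_rat r * (of_rat f)\<^sup>2)"
     "(\<lambda>t. h t - (\<Sum>(r,f)\<leftarrow>ys. of_rat r * E_Delta (of_rat f * t))) \<in> O[at_top](\<lambda>t. t)"
    using assms(2) unfolding E_Delta_combination_def by blast
  have "\<forall>(r,f)\<in>set (xs @ ys). f > 0 \<and> (pos \<longrightarrow> r > 0)" using xs(1) ys(1) by auto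
  moreover have "m + n = (\<Sum>(r,f)\<leftarrow>xs @ ys. of_rat r * (of_rat f)\<^sup>2)" using xs(2) ys(2) by simp
  moreover have "(\<lambda>t. g t + h t - (\<Sum>(r,f)\<leftarrow>xs @ ys. of_rat r * E_Delta (of_rat f * t))) \<in> O[at_top](\<lambda>t. t)"
    using sum_in_bigo(1)[OF xs(3) ys(3)] by (simp add: algebra_simps)
  ultimately show ?thesis unfolding E_Delta_combination_def by blast
qed

lemma E_Delta_combination_zero: "E_Delta_combination pos (\<lambda>_. 0) 0"
  unfolding E_Delta_combination_def by (intro exI[of _ "[]"]) simp

lemma E_Delta_combination_sum:
  assumes "finite I" "\<And>i. i \<in> I \<Longrightarrow> E_Delta_combination pos (g i) (m i)"
  shows "E_Delta_combination pos (\<lambda>t. \<Sum>i\<in>I. g i t) (\<Sum>i\<in>I. m i)"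
  using assms
proof (induction I rule: finite_induct)
  case empty
  then show ?case using E_Delta_combination_zero by simp
next
  case (insert i I)
  then show ?case using E_Delta_combination_add[of pos "g i" "m i"] by simp
qed

lemma E_Delta_combination_bigo:
  assumes "E_Delta_combination pos g m" "(\<lambda>t. h t - g t) \<in> O[at_top](\<lambda>t. t)"
  shows "E_Delta_combination pos h m"
proof -
  obtain xs :: "(rat \<times> rat) list" where xs: "\<forall>(r,f)\<in>set xs. f > 0 \<and> (pos \<longrightarrow> r > 0)"
     "m = (\<Sum>(r,f)\<leftarrow>xs. of_rat r * (of_rat f)\<^sup>2)"
     "(\<lambda>t. g t - (\<Sum>(r,f)\<leftarrow>xs. of_rat r * E_Delta (of_rat f * t))) \<in> O[at_top](\<lambda>t. t)"
    using assms(1) unfolding E_Delta_combination_def by blast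
  have "(\<lambda>t. h t - (\<Sum>(r,f)\<leftarrow>xs. of_rat r * E_Delta (of_rat f * t))) \<in> O[at_top](\<lambda>t. t)"
    using sum_in_bigo(1)[OF assms(2) xs(3)] by simp
  then show ?thesis using xs(1,2) unfolding E_Delta_combination_def by blast
qed

text \<open>A zero coefficient would violate \<open>r > 0\<close>, so in that case the empty list is
  taken; the term contributes 0 to the second component as well.\<close>

lemma E_Delta_combination_single:
  assumes "(\<lambda>t. g t - r * E_Delta (f * t)) \<in> O[at_top](\<lambda>t. t)" "r \<in> \<rat>" "f \<in> \<rat>" "f > 0" "pos \<longrightarrow> r \<ge> 0"
  shows "E_Delta_combination pos g (r * f\<^sup>2)"
proof -
  obtain r' f' where rf: "r = of_rat r'" "f = of_rat f'" using assms by (auto elim!: Rats_cases)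
  show ?thesis
  proof (cases "r = 0")
    case True
    then show ?thesis using assms(1) unfolding E_Delta_combination_def by (intro exI[of _ "[]"]) simp
  next
    case False
    then have "pos \<longrightarrow> r' > 0" using assms(5) by (auto simp: rf)
    then show ?thesis using assms(1,4) unfolding E_Delta_combination_def
      by (intro exI[of _ "[(r',f')]"]) (simp add: rf)
  qed
qed

lemma E_Delta_combination_lattice_triangle:
  assumes "(p * s - q * r) * (p * s - q * r) = 1" "f > 0" "A < B" "f \<in> \<rat>" "A \<in> \<rat>" "B \<in> \<rat>"
    and "c \<in> \<rat>" "pos \<longrightarrow> c \<ge> 0"
  shows "E_Delta_combination pos (\<lambda>t. c * E_polygon (lattice_triangle p q r s f A B) t)
           (c * (2 * measure lebesgue (lattice_triangle p q r s f A B)))"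
proof -
  have "(\<lambda>t. c * (E_polygon (lattice_triangle p q r s f A B) t - (B - A) * E_Delta (f * t))) \<in> O[at_top](\<lambda>t. t)"
    using E_lattice_triangle[OF assms(1,2,5,6,3)] by simp
  then have "(\<lambda>t. c * E_polygon (lattice_triangle p q r s f A B) t - (c * (B - A)) * E_Delta (f * t)) \<in> O[at_top](\<lambda>t. t)"
    by (simp only: right_diff_distrib[of c "E_polygon _ _"] mult.assoc)
  then have "E_Delta_combination pos (\<lambda>t. c * E_polygon (lattice_triangle p q r s f A B) t) ((c * (B - A)) * f\<^sup>2)"
    by (rule E_Delta_combination_single) (use assms in \<open>auto intro!: Rats_mult Rats_diff\<close>)
  moreover have "c * (2 * measure lebesgue (lattice_triangle p q r s f A B)) = (c * (B - A)) * f\<^sup>2"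
    using lattice_triangle_measure(1)[OF assms(1-3)] by simp
  ultimately show ?thesis by (simp only:)
qed

section \<open>Gluing the four sectors\<close>

text \<open>The matrix with rows \<open>(a, b)\<close> and \<open>(c, d)\<close> is an integer
  involution, so it leads both to the coordinates \<open>X\<close>, \<open>Y\<close> and back. It
  carries the cone to the sector of \<open>sector_decomposition\<close>; composed with the lattice
  coordinates of a wedge it keeps the determinant at 1 or -1.\<close>

lemma E_polygon_cone:
  fixes S :: "(real^2) set" and L :: "(real \<times> real \<times> real) set" and a b c d :: int
  assumes inv: "a * a + b * c = 1" "a * b + b * d = 0" "c * a + d * c = 0" "c * b + d * d = 1"
    and S: "bounded S" "S \<in> lmeasurable"
    and finL: "finite L"
    and rat: "\<And>u v w. (u,v,w) \<in> L \<Longrightarrow> u \<in> \<rat> \<and> v \<in> \<rat> \<and> w \<in> \<rat>"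
    and nondeg: "\<And>u v w. (u,v,w) \<in> L \<Longrightarrow> u \<noteq> 0 \<or> v \<noteq> 0"
    and cell: "\<And>p q. (\<And>u v w. (u,v,w) \<in> L \<Longrightarrow> 0 < (u * p$1 + v * p$2 - w) * (u * q$1 + v * q$2 - w)) \<Longrightarrow> p \<in> S \<Longrightarrow> q \<in> S"
    and star: "\<And>p \<theta>. pos \<Longrightarrow> p \<in> S \<Longrightarrow> 0 < \<theta> \<Longrightarrow> \<theta> \<le> 1 \<Longrightarrow> \<theta> *\<^sub>R p \<in> S"
  defines "C \<equiv> S \<inter> {p. \<bar>of_int c * p$1 + of_int d * p$2\<bar> < of_int a * p$1 + of_int b * p$2}"
  shows "C \<in> lmeasurable" "E_Delta_combination pos (E_polygon C) (2 * measure lebesgue C)"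
proof -
  define a' b' c' d' :: real where defs: "a' = of_int a" "b' = of_int b" "c' = of_int c" "d' = of_int d"
  have inv': "a' * a' + b' * c' = 1" "a' * b' + b' * d' = 0" "c' * a' + d' * c' = 0" "c' * b' + d' * d' = 1"
    unfolding defs of_int_mult[symmetric] of_int_add[symmetric] inv by simp_all
  have rats: "a' \<in> \<rat>" "b' \<in> \<rat>" "c' \<in> \<rat>" "d' \<in> \<rat>" by (simp_all add: defs)
  define X Y where "X p = a' * p$1 + b' * p$2" and "Y p = c' * p$1 + d' * p$2" for p :: "real^2"
  define W :: "real \<Rightarrow> real \<Rightarrow> real^2" where "W x y = vector [a' * x + b' * y, c' * x + d' * y]" for x y
  have WXY: "W (X p) (Y p) = p" for p
  proof -
    have "a' * X p + b' * Y p = (a' * a' + b' * c') * p$1 + (a' * b' + b' * d') * p$2"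
      "c' * X p + d' * Y p = (c' * a' + d' * c') * p$1 + (c' * b' + d' * d') * p$2"
      by (simp_all add: X_def Y_def algebra_simps)
    then show ?thesis by (simp add: W_def vec_eq_iff forall_2 inv')
  qed
  have XW: "X (W x y) = x" for x y
  proof -
    have "X (W x y) = (a' * a' + b' * c') * x + (a' * b' + b' * d') * y"
      by (simp add: X_def W_def algebra_simps)
    then show ?thesis by (simp add: inv')
  qed
  have C: "C = S \<inter> {p. \<bar>Y p\<bar> < X p}" by (simp add: C_def X_def Y_def defs)
  have "open {p. \<bar>Y p\<bar> < X p}" unfolding X_def Y_def by (intro open_Collect_less continuous_intros)
  then show Cm: "C \<in> lmeasurable" unfolding C using S(2) by (intro fmeasurable_Int_fmeasurable) auto
  have Cb: "bounded C" using S(1) unfolding C by (rule bounded_subset) auto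
  \<comment> \<open>In the new coordinates the normal \<open>(u, v)\<close> of a line is multiplied
    by the matrix from the right, and the constant is kept.\<close>
  define tr where "tr = (\<lambda>(u,v,w). (u * a' + v * c', u * b' + v * d', w :: real))"
  have nd: "u * a' + v * c' \<noteq> 0 \<or> u * b' + v * d' \<noteq> 0" if "u \<noteq> 0 \<or> v \<noteq> 0" for u v
  proof (rule ccontr)
    assume "\<not> ?thesis"
    then have z: "u * a' + v * c' = 0" "u * b' + v * d' = 0" by auto
    have "u = (u * a' + v * c') * a' + (u * b' + v * d') * c'"
      using inv' by algebra
    moreover have "v = (u * a' + v * c') * b' + (u * b' + v * d') * d'"
      using inv' by algebra
    ultimately show False using that unfolding z by simp
  qed
  obtain R where R: "\<And>p. p \<in> S \<Longrightarrow> norm p \<le> R" using S(1) unfolding bounded_iff by blast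
  have trW: "(case tr l of (u,v,w) \<Rightarrow> u * x + v * y - w) = (case l of (u,v,w) \<Rightarrow> u * W x y $ 1 + v * W x y $ 2 - w)" for l x y
    by (simp add: tr_def W_def algebra_simps split: prod.splits)
  obtain I :: "((real \<times> real) \<times> (real \<times> real)) set" and k :: "(real \<times> real) \<times> (real \<times> real) \<Rightarrow> real"
      and L' :: "(real \<times> real \<times> real) set" where
    fin: "finite I" "finite L'" and nd': "\<And>u v w. (u,v,w) \<in> L' \<Longrightarrow> u \<noteq> 0 \<or> v \<noteq> 0"
    and I: "\<And>\<alpha> \<beta> u v. ((\<alpha>,\<beta>),(u,v)) \<in> I \<Longrightarrow> \<alpha> \<in> \<rat> \<and> \<beta> \<in> \<rat> \<and> u \<in> \<rat> \<and> v \<in> \<rat> \<and> \<alpha> < \<beta> \<and> u + v * \<alpha> > 0 \<and> u + v * \<beta> > 0"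
    and krat: "\<And>i. k i \<in> \<rat>"
    and dec: "\<And>x y. (\<And>u v w. (u,v,w) \<in> L' \<Longrightarrow> u * x + v * y \<noteq> w) \<Longrightarrow>
      of_bool (\<bar>y\<bar> < x \<and> W x y \<in> S) = (\<Sum>((\<alpha>,\<beta>),(u,v))\<in>I. k ((\<alpha>,\<beta>),(u,v)) * of_bool (\<alpha> * x < y \<and> y \<le> \<beta> * x \<and> u * x + v * y \<le> 1))"
    and kpos: "\<And>i. pos \<Longrightarrow> i \<in> I \<Longrightarrow> k i \<ge> 0"
  \<comment> \<open>On \<open>S\<close> the coordinate \<open>X\<close> is at most
    \<open>(\<bar>a'\<bar> + \<bar>b'\<bar>) * R\<close>; adding 1 makes the bound strict.\<close>
  proof (rule sector_decomposition[of "tr ` L" "\<lambda>x y. W x y \<in> S" "(\<bar>a'\<bar> + \<bar>b'\<bar>) * R + 1"])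
    show "finite (tr ` L)" using finL by simp
    show "u \<in> \<rat> \<and> v \<in> \<rat> \<and> w \<in> \<rat>" if "(u,v,w) \<in> tr ` L" for u v w
      using that rat rats by (auto simp: tr_def intro!: Rats_add Rats_mult)
    show "u \<noteq> 0 \<or> v \<noteq> 0" if "(u,v,w) \<in> tr ` L" for u v w
    proof -
      from that obtain u' v' where "(u',v',w) \<in> L" "u = u' * a' + v' * c'" "v = u' * b' + v' * d'"
        by (auto simp: tr_def)
      then show ?thesis using nd[OF nondeg] by simp
    qed
    show "W x' y' \<in> S" if h: "\<And>u v w. (u,v,w) \<in> tr ` L \<Longrightarrow> 0 < (u * x + v * y - w) * (u * x' + v * y' - w)"
      and "W x y \<in> S" for x y x' y'
    proof (rule cell[OF _ that(2)])
      fix u v w assume l: "(u,v,w) \<in> L"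
      obtain u' v' w' where t: "tr (u,v,w) = (u',v',w')" by (metis surj_pair)
      then have "(u',v',w') \<in> tr ` L" using l by (metis image_eqI)
      from h[OF this] trW[where l="(u,v,w)" and x=x and y=y] trW[where l="(u,v,w)" and x=x' and y=y']
      show "0 < (u * W x y $ 1 + v * W x y $ 2 - w) * (u * W x' y' $ 1 + v * W x' y' $ 2 - w)"
        by (simp add: t)
    qed
    show "x < (\<bar>a'\<bar> + \<bar>b'\<bar>) * R + 1" if "W x y \<in> S" for x y
    proof -
      have "x = a' * W x y $ 1 + b' * W x y $ 2" using XW[of x y] by (simp add: X_def)
      also have "\<dots> \<le> \<bar>a'\<bar> * \<bar>W x y $ 1\<bar> + \<bar>b'\<bar> * \<bar>W x y $ 2\<bar>"
        unfolding abs_mult[symmetric] by (intro add_mono abs_ge_self)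
      also have "\<dots> \<le> \<bar>a'\<bar> * R + \<bar>b'\<bar> * R"
        using R[OF that] component_le_norm_cart[of "W x y"]
        by (intro add_mono mult_left_mono) (auto intro: order_trans)
      finally show ?thesis by (simp add: algebra_simps)
    qed
  next
    fix I :: "((real \<times> real) \<times> (real \<times> real)) set" and k :: "(real \<times> real) \<times> (real \<times> real) \<Rightarrow> real"
      and L' :: "(real \<times> real \<times> real) set"
    assume h: "finite I" "finite L'" "\<And>u v w. (u,v,w) \<in> L' \<Longrightarrow> u \<noteq> 0 \<or> v \<noteq> 0"
      "\<And>\<alpha> \<beta> u v. ((\<alpha>,\<beta>),(u,v)) \<in> I \<Longrightarrow> \<alpha> \<in> \<rat> \<and> \<beta> \<in> \<rat> \<and> u \<in> \<rat> \<and> v \<in> \<rat> \<and> \<alpha> < \<beta> \<and> u + v * \<alpha> > 0 \<and> u + v * \<beta> > 0"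
      "\<And>i. k i \<in> \<rat>"
      "\<And>x y. (\<And>u v w. (u,v,w) \<in> L' \<Longrightarrow> u * x + v * y \<noteq> w) \<Longrightarrow>
        of_bool (\<bar>y\<bar> < x \<and> W x y \<in> S) = (\<Sum>((\<alpha>,\<beta>),(u,v))\<in>I. k ((\<alpha>,\<beta>),(u,v)) * of_bool (\<alpha> * x < y \<and> y \<le> \<beta> * x \<and> u * x + v * y \<le> 1))"
      "(\<And>x y \<theta>. W x y \<in> S \<Longrightarrow> 0 < \<theta> \<Longrightarrow> \<theta> \<le> 1 \<Longrightarrow> W (\<theta> * x) (\<theta> * y) \<in> S) \<Longrightarrow> (\<And>i. i \<in> I \<Longrightarrow> k i \<ge> 0)"
    have "W (\<theta> * x) (\<theta> * y) = \<theta> *\<^sub>R W x y" for \<theta> x y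
      by (simp add: W_def vec_eq_iff forall_2 algebra_simps)
    then have "k i \<ge> 0" if "pos" "i \<in> I" for i
      using h(7)[OF _ that(2)] star[OF that(1)] by simp
    with h(1-6) show thesis by (rule that)
  qed
  define T where "T = (\<lambda>((\<alpha>,\<beta>),(u,v)). {p. \<alpha> * X p < Y p \<and> Y p \<le> \<beta> * X p \<and> u * X p + v * Y p \<le> 1})"
  have T: "T i \<in> lmeasurable \<and> bounded (T i) \<and>
      E_Delta_combination pos (\<lambda>t. k i * E_polygon (T i) t) (k i * (2 * measure lebesgue (T i)))" if i: "i \<in> I" for i
  proof -
    obtain \<alpha> \<beta> u v where iv: "i = ((\<alpha>,\<beta>),(u,v))" by (metis surj_pair)
    note II = I[OF i[unfolded iv]]
    from II have "\<alpha> \<in> \<rat>" "\<beta> \<in> \<rat>" "u \<in> \<rat>" "v \<in> \<rat>" "\<alpha> < \<beta>" "u + v * \<alpha> > 0" "u + v * \<beta> > 0" by auto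
    then obtain p q r s :: int and f A B :: real where
      w: "p * s - q * r = 1" "f > 0" "A < B" "f \<in> \<rat>" "A \<in> \<rat>" "B \<in> \<rat>"
      "\<And>x y. (\<alpha> * x < y \<and> y \<le> \<beta> * x \<and> u * x + v * y \<le> 1) \<longleftrightarrow>
         (0 < of_int p * x + of_int q * y \<and> of_int p * x + of_int q * y \<le> f
          \<and> A * (of_int p * x + of_int q * y) < of_int r * x + of_int s * y
          \<and> of_int r * x + of_int s * y \<le> B * (of_int p * x + of_int q * y))"
      by (rule wedge_as_lattice_triangle) blast
    define p' q' r' s' where d: "p' = p * a + q * c" "q' = p * b + q * d" "r' = r * a + s * c" "s' = r * b + s * d"
    have "p' * s' - q' * r' = (p * s - q * r) * (a * d - b * c)" by (simp add: d algebra_simps)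
    moreover have "(a * d - b * c) * (a * d - b * c) = 1" using inv by algebra
    ultimately have det: "(p' * s' - q' * r') * (p' * s' - q' * r') = 1" using w(1) by simp
    have co: "of_int p * X z + of_int q * Y z = of_int p' * z$1 + of_int q' * z$2"
      "of_int r * X z + of_int s * Y z = of_int r' * z$1 + of_int s' * z$2" for z
      by (simp_all add: X_def Y_def d defs algebra_simps)
    have Teq: "T i = lattice_triangle p' q' r' s' f A B"
      unfolding T_def iv lattice_triangle_def prod.case w(7) co ..
    show ?thesis unfolding Teq
      using lattice_triangle_measure[OF det w(2,3)] E_Delta_combination_lattice_triangle[OF det w(2-6) krat] kpos[OF _ i]
      by blast
  qed
  have eq: "indicator C p = (\<Sum>i\<in>I. k i * indicator (T i) p)"
    if off: "\<And>u v w. (u,v,w) \<in> tr ` L' \<Longrightarrow> u * p$1 + v * p$2 \<noteq> w" for p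
  proof -
    have off': "u * X p + v * Y p \<noteq> w" if "(u,v,w) \<in> L'" for u v w
    proof -
      have "(u * a' + v * c', u * b' + v * d', w) \<in> tr ` L'"
        unfolding tr_def by (rule image_eqI[OF _ that]) simp
      from off[OF this] show ?thesis by (simp add: X_def Y_def algebra_simps)
    qed
    have "indicator C p = of_bool (\<bar>Y p\<bar> < X p \<and> W (X p) (Y p) \<in> S)"
      by (auto simp: C WXY indicator_def)
    also have "\<dots> = (\<Sum>((\<alpha>,\<beta>),(u,v))\<in>I. k ((\<alpha>,\<beta>),(u,v)) * of_bool (\<alpha> * X p < Y p \<and> Y p \<le> \<beta> * X p \<and> u * X p + v * Y p \<le> 1))"
      by (rule dec) (rule off')
    also have "\<dots> = (\<Sum>i\<in>I. k i * indicator (T i) p)"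
      by (intro sum.cong refl) (auto simp: T_def indicator_def)
    finally show ?thesis .
  qed
  have nd'': "u \<noteq> 0 \<or> v \<noteq> 0" if "(u,v,w) \<in> tr ` L'" for u v w
  proof -
    from that obtain u' v' where "(u',v',w) \<in> L'" "u = u' * a' + v' * c'" "v = u' * b' + v' * d'"
        by (auto simp: tr_def)
    then show ?thesis using nd[OF nd'] by simp
  qed
  have Tm: "T i \<in> lmeasurable" and Tb: "bounded (T i)" if "i \<in> I" for i using T[OF that] by blast+
  have trL: "finite (tr ` L')" using fin(2) by (rule finite_imageI)
  have comb: "E_Delta_combination pos (\<lambda>t. \<Sum>i\<in>I. k i * E_polygon (T i) t) (\<Sum>i\<in>I. k i * (2 * measure lebesgue (T i)))"
    by (rule E_Delta_combination_sum) (use fin T in auto)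
  have "measure lebesgue C = (\<Sum>i\<in>I. k i * measure lebesgue (T i))"
    by (rule measure_combination[where L = "tr ` L'", OF fin(1) Cm Tm trL]) (assumption, fact nd'', fact eq)
  then have meas: "(\<Sum>i\<in>I. k i * (2 * measure lebesgue (T i))) = 2 * measure lebesgue C"
    by (simp add: sum_distrib_left mult.left_commute)
  have diff: "(\<lambda>t. E_polygon C t - (\<Sum>i\<in>I. k i * E_polygon (T i) t)) \<in> O[at_top](\<lambda>t. t)"
    by (rule E_polygon_combination[where L = "tr ` L'", OF fin(1) Cb Cm Tb Tm trL]) (assumption, assumption, fact nd'', fact eq)
  show "E_Delta_combination pos (E_polygon C) (2 * measure lebesgue C)"
    using comb diff unfolding meas by (rule E_Delta_combination_bigo)
qed

text \<open>Up to the diagonals, the cones cut out by \<open>(X,Y) = (x,y), (-x,-y), (y,x), (-y,-x)\<close> cover the plane.\<close>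
lemma E_Delta_combination_cells:
  fixes S :: "(real^2) set" and L :: "(real \<times> real \<times> real) set"
  assumes S: "bounded S" "S \<in> lmeasurable"
    and L: "finite L" "\<And>u v w. (u,v,w) \<in> L \<Longrightarrow> u \<in> \<rat> \<and> v \<in> \<rat> \<and> w \<in> \<rat>"
      "\<And>u v w. (u,v,w) \<in> L \<Longrightarrow> u \<noteq> 0 \<or> v \<noteq> 0"
    and cell: "\<And>p q. (\<And>u v w. (u,v,w) \<in> L \<Longrightarrow> 0 < (u * p$1 + v * p$2 - w) * (u * q$1 + v * q$2 - w)) \<Longrightarrow> p \<in> S \<Longrightarrow> q \<in> S"
    and star: "\<And>p \<theta>. pos \<Longrightarrow> p \<in> S \<Longrightarrow> 0 < \<theta> \<Longrightarrow> \<theta> \<le> 1 \<Longrightarrow> \<theta> *\<^sub>R p \<in> S"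
  shows "E_Delta_combination pos (E_polygon S) (2 * measure lebesgue S)"
proof -
  define M :: "(int \<times> int \<times> int \<times> int) set" where "M = {(1,0,0,1), (-1,0,0,-1), (0,1,1,0), (0,-1,-1,0)}"
  define C where "C = (\<lambda>(a,b,c,d). S \<inter> {p. \<bar>of_int c * p$1 + of_int d * p$2\<bar> < of_int a * p$1 + of_int b * p$2})"
  have C: "C m \<in> lmeasurable" "E_Delta_combination pos (E_polygon (C m)) (2 * measure lebesgue (C m))" if "m \<in> M" for m
  proof -
    obtain a b c d where m: "m = (a,b,c,d)" by (metis surj_pair)
    have inv: "a * a + b * c = 1" "a * b + b * d = 0" "c * a + d * c = 0" "c * b + d * d = 1"
      using that by (auto simp: M_def m)
    show "C m \<in> lmeasurable" "E_Delta_combination pos (E_polygon (C m)) (2 * measure lebesgue (C m))"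
      unfolding C_def m prod.case
      by (rule E_polygon_cone[where L = L, OF inv S L(1)], fact L(2), fact L(3), fact cell, (fact star)?)+
  qed
  have Cb: "bounded (C m)" for m using S(1) by (rule bounded_subset) (auto simp: C_def split: prod.splits)
  \<comment> \<open>The two diagonals, which are exactly the points outside all four open
    sectors.\<close>
  define D :: "(real \<times> real \<times> real) set" where "D = {(1,1,0), (1,-1,0)}"
  have finM: "finite M" by (simp add: M_def)
  have sumM: "sum h M = h (1,0,0,1) + h (-1,0,0,-1) + h (0,1,1,0) + h (0,-1,-1,0)" for h :: "_ \<Rightarrow> real"
    by (simp add: M_def)
  have eq: "indicat_real S p = (\<Sum>m\<in>M. 1 * indicator (C m) p)" if off: "\<And>u v w. (u,v,w) \<in> D \<Longrightarrow> u * p$1 + v * p$2 \<noteq> w" for p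
  proof -
    have "p$1 + p$2 \<noteq> 0" "p$1 - p$2 \<noteq> 0" using off[of 1 1 0] off[of 1 "-1" 0] by (auto simp: D_def)
    then have "indicat_real S p = indicator (C (1,0,0,1)) p + indicator (C (-1,0,0,-1)) p
        + indicator (C (0,1,1,0)) p + indicator (C (0,-1,-1,0)) p"
      by (auto simp: C_def indicator_def abs_if)
    then show ?thesis unfolding sumM by simp
  qed
  have D: "finite D" "\<And>u v w. (u,v,w) \<in> D \<Longrightarrow> u \<noteq> 0 \<or> v \<noteq> 0" by (auto simp: D_def)
  have "measure lebesgue S = (\<Sum>m\<in>M. 1 * measure lebesgue (C m))"
    by (rule measure_combination[where L = D, OF finM S(2) C(1) D(1)]) (assumption, fact D(2), fact eq)
  moreover have "(\<lambda>t. E_polygon S t - (\<Sum>m\<in>M. 1 * E_polygon (C m) t)) \<in> O[at_top](\<lambda>t. t)"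
    by (rule E_polygon_combination[where L = D, OF finM S Cb C(1) D(1)]) (assumption, fact D(2), fact eq)
  moreover have "E_Delta_combination pos (\<lambda>t. \<Sum>m\<in>M. E_polygon (C m) t) (\<Sum>m\<in>M. 2 * measure lebesgue (C m))"
    by (rule E_Delta_combination_sum[OF finM C(2)])
  ultimately show ?thesis using E_Delta_combination_bigo by (simp add: sum_distrib_left)
qed

text \<open>An empty list would give \<open>k = 0\<close>. If the signs are free, it is replaced by
  one term with coefficient 0; under \<open>pos\<close> it is excluded by
  \<open>m \<noteq> 0\<close>.\<close>

lemma E_Delta_combination_indexed:
  assumes "E_Delta_combination pos g m" "\<not> pos \<or> m \<noteq> 0"
  shows "\<exists>(k::nat) (r::nat \<Rightarrow> rat) (f::nat \<Rightarrow> rat).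
            k > 0 \<and> (\<forall>j\<in>{1..k}. f j > 0) \<and> (pos \<longrightarrow> (\<forall>j\<in>{1..k}. r j > 0)) \<and>
            (\<lambda>t::real. g t - (\<Sum>j=1..k. of_rat (r j) * E_Delta (of_rat (f j) * t))) \<in> O[at_top](\<lambda>t. t)"
proof -
  obtain xs :: "(rat \<times> rat) list" where xs: "\<forall>(r,f)\<in>set xs. f > 0 \<and> (pos \<longrightarrow> r > 0)"
     "m = (\<Sum>(r,f)\<leftarrow>xs. of_rat r * (of_rat f)\<^sup>2)"
     "(\<lambda>t. g t - (\<Sum>(r,f)\<leftarrow>xs. of_rat r * E_Delta (of_rat f * t))) \<in> O[at_top](\<lambda>t. t)"
    using assms(1) unfolding E_Delta_combination_def by blast
  show ?thesis
  proof (cases "xs = []")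
    case True
    then have "\<not> pos" using xs(2) assms(2) by simp
    then show ?thesis using xs(3) True
      by (intro exI[of _ "1::nat"] exI[of _ "\<lambda>_. 0::rat"] exI[of _ "\<lambda>_. 1::rat"]) simp
  next
    case False
    define k where "k = length xs"
    have mem: "xs ! (j - 1) \<in> set xs" if "j \<in> {1..k}" for j using that by (auto simp: k_def)
    have sum: "(\<Sum>(r,f)\<leftarrow>xs. of_rat r * E_Delta (of_rat f * t))
       = (\<Sum>j=1..k. of_rat (fst (xs ! (j - 1))) * E_Delta (of_rat (snd (xs ! (j - 1))) * t))" for t
    proof -
      have "(\<Sum>(r,f)\<leftarrow>xs. of_rat r * E_Delta (of_rat f * t))
        = (\<Sum>j<k. of_rat (fst (xs ! j)) * E_Delta (of_rat (snd (xs ! j)) * t))"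
        by (simp add: sum_list_sum_nth k_def case_prod_unfold atLeast0LessThan)
      also have "\<dots> = (\<Sum>j=1..k. of_rat (fst (xs ! (j - 1))) * E_Delta (of_rat (snd (xs ! (j - 1))) * t))"
        by (rule sum.reindex_bij_witness[of _ "\<lambda>j. j - 1" Suc]) auto
      finally show ?thesis .
    qed
    have fp: "snd (xs ! (j - 1)) > 0 \<and> (pos \<longrightarrow> fst (xs ! (j - 1)) > 0)" if "j \<in> {1..k}" for j
      using bspec[OF xs(1) mem[OF that]] by (simp add: case_prod_unfold)
    show ?thesis
    proof (intro exI conjI ballI impI)
      show "k > 0" using False by (simp add: k_def)
      show "snd (xs ! (j - 1)) > 0" if "j \<in> {1..k}" for j using fp[OF that] by simp
      show "fst (xs ! (j - 1)) > 0" if pos "j \<in> {1..k}" for j using fp[OF that(2)] that(1) by simp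
      show "(\<lambda>t. g t - (\<Sum>j=1..k. of_rat (fst (xs ! (j - 1))) * E_Delta (of_rat (snd (xs ! (j - 1))) * t))) \<in> O[at_top](\<lambda>t. t)"
        using xs(3) unfolding sum .
    qed
  qed
qed

section \<open>Polygons\<close>

text \<open>The normal is the vector \<open>w - v\<close> turned by a right angle, hence rational. A
  degenerate segment gets the vertical line through its point.\<close>

lemma rational_line_through:
  fixes v w :: "real^2"
  assumes "v$1 \<in> \<rat>" "v$2 \<in> \<rat>" "w$1 \<in> \<rat>" "w$2 \<in> \<rat>"
  obtains a b d :: real where "a \<in> \<rat>" "b \<in> \<rat>" "d \<in> \<rat>" "a \<noteq> 0 \<or> b \<noteq> 0"
    "closed_segment v w \<subseteq> {p. a * p$1 + b * p$2 = d}"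
proof (cases "v = w")
  case True
  show ?thesis by (rule that[of 1 0 "v$1"]) (use True assms in auto)
next
  case False
  show ?thesis
  proof (rule that[of "w$2 - v$2" "v$1 - w$1" "(w$2 - v$2) * v$1 + (v$1 - w$1) * v$2"])
    show "w$2 - v$2 \<noteq> 0 \<or> v$1 - w$1 \<noteq> 0" using False by (auto simp: vec_eq_iff forall_2)
    show "closed_segment v w \<subseteq> {p. (w$2 - v$2) * p$1 + (v$1 - w$1) * p$2 = (w$2 - v$2) * v$1 + (v$1 - w$1) * v$2}"
    proof
      fix p assume "p \<in> closed_segment v w"
      then obtain u where u: "p = (1 - u) *\<^sub>R v + u *\<^sub>R w" by (auto simp: closed_segment_def)
      show "p \<in> {p. (w$2 - v$2) * p$1 + (v$1 - w$1) * p$2 = (w$2 - v$2) * v$1 + (v$1 - w$1) * v$2}"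
        unfolding mem_Collect_eq u vector_add_component vector_scaleR_component real_scaleR_def
        by (simp add: algebra_simps)
    qed
  qed (use assms in \<open>auto intro!: Rats_add Rats_mult Rats_diff\<close>)
qed

definition rational_lines :: "(real \<times> real \<times> real) set \<Rightarrow> bool" where
  "rational_lines L \<longleftrightarrow> finite L \<and> (\<forall>(a,b,d)\<in>L. a \<in> \<rat> \<and> b \<in> \<rat> \<and> d \<in> \<rat> \<and> (a \<noteq> 0 \<or> b \<noteq> 0))"

lemma polygonal_path_rational_lines:
  fixes vs :: "(real^2) list"
  assumes "\<forall>v\<in>set vs. v$1 \<in> \<rat> \<and> v$2 \<in> \<rat>"
  shows "\<exists>L. rational_lines L \<and> path_image (polygonal_path vs) \<subseteq> {p. \<exists>(a,b,d)\<in>L. a * p$1 + b * p$2 = d}"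
proof -
  have seg: "\<exists>L. rational_lines L \<and> path_image (linepath v w) \<subseteq> {p. \<exists>(a,b,d)\<in>L. a * p$1 + b * p$2 = d}"
    if vw: "v$1 \<in> \<rat> \<and> v$2 \<in> \<rat>" "w$1 \<in> \<rat> \<and> w$2 \<in> \<rat>" for v w :: "real^2"
  proof -
    obtain a b d :: real where abd: "a \<in> \<rat>" "b \<in> \<rat>" "d \<in> \<rat>" "a \<noteq> 0 \<or> b \<noteq> 0"
      "closed_segment v w \<subseteq> {p. a * p$1 + b * p$2 = d}"
      by (rule rational_line_through[of v w]) (use vw in auto)
    have "rational_lines {(a,b,d)}" using abd(1-4) by (simp add: rational_lines_def)
    moreover have "path_image (linepath v w) \<subseteq> {p. \<exists>(a,b,d)\<in>{(a,b,d)}. a * p$1 + b * p$2 = d}"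
      using abd(5) by simp
    ultimately show ?thesis by blast
  qed
  show ?thesis using assms
  proof (induction vs rule: polygonal_path.induct)
    case 1
    show ?case unfolding polygonal_path.simps by (rule seg) simp_all
  next
    case (2 a)
    then show ?case unfolding polygonal_path.simps by (intro seg) simp_all
  next
    case (3 a b)
    then show ?case unfolding polygonal_path.simps by (intro seg) simp_all
  next
    case (4 a b c vs)
    obtain L1 where L1: "rational_lines L1" "path_image (linepath a b) \<subseteq> {p. \<exists>(a,b,d)\<in>L1. a * p$1 + b * p$2 = d}"
      using seg[of a b] 4(2) by auto
    obtain L2 where L2: "rational_lines L2"
      "path_image (polygonal_path (b # c # vs)) \<subseteq> {p. \<exists>(a,b,d)\<in>L2. a * p$1 + b * p$2 = d}"
      using 4 by auto
    have "rational_lines (L1 \<union> L2)" using L1 L2 by (auto simp: rational_lines_def)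
    moreover have "path_image (polygonal_path (a # b # c # vs)) \<subseteq> {p. \<exists>(a,b,d)\<in>L1 \<union> L2. a * p$1 + b * p$2 = d}"
      using path_image_join_subset[of "linepath a b" "polygonal_path (b # c # vs)"] L1(2) L2(2)
      unfolding polygonal_path.simps by blast
    ultimately show ?case by blast
  qed
qed

lemma polygonal_path_ends:
  assumes "vs \<noteq> []"
  shows "pathstart (polygonal_path vs) = hd vs \<and> pathfinish (polygonal_path vs) = last vs"
  using assms by (induction vs rule: polygonal_path.induct) auto

text \<open>At a common point a convex combination of two numbers \<open>P\<close>, \<open>Q\<close>
  of the same strict sign would vanish. Multiplied by \<open>P\<close> it becomes a sum of two
  nonnegative terms that cannot both be 0.\<close>

lemma segment_avoids_lines:
  fixes p q :: "real^2"
  assumes "\<And>u v w. (u,v,w) \<in> L \<Longrightarrow> 0 < (u * p$1 + v * p$2 - w) * (u * q$1 + v * q$2 - w)"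
  shows "closed_segment p q \<inter> {z. \<exists>(a,b,d)\<in>L. a * z$1 + b * z$2 = d} = {}"
proof (rule ccontr)
  assume "\<not> ?thesis"
  then obtain z a b d where z: "z \<in> closed_segment p q" "(a,b,d) \<in> L" "a * z$1 + b * z$2 = d" by blast
  then obtain t where t: "0 \<le> t" "t \<le> 1" "z = (1 - t) *\<^sub>R p + t *\<^sub>R q" by (auto simp: closed_segment_def)
  define P Q where "P = a * p$1 + b * p$2 - d" and "Q = a * q$1 + b * q$2 - d"
  have PQ: "0 < P * Q" using assms[OF z(2)] by (simp add: P_def Q_def)
  have "(1 - t) * P + t * Q = a * z$1 + b * z$2 - d" by (simp add: t(3) P_def Q_def algebra_simps)
  then have sum: "(1 - t) * P + t * Q = 0" using z(3) by simp
  have "((1 - t) * P + t * Q) * P = (1 - t) * (P * P) + t * (P * Q)" by (simp add: algebra_simps)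
  then have "(1 - t) * (P * P) + t * (P * Q) = 0" using sum by simp
  moreover have "0 \<le> (1 - t) * (P * P)" "0 \<le> t * (P * Q)" using t PQ by auto
  ultimately have "(1 - t) * (P * P) = 0" "t * (P * Q) = 0" by linarith+
  then show False using PQ by auto
qed

text \<open>A homeomorphic image of a circle disconnects the plane, by Jordan-Brouwer separation,
  whereas the outside alone is connected. This gives the polygon positive area and so a nonempty
  combination in the star-shaped case.\<close>

lemma inside_simple_closed_path_nonempty:
  fixes c :: "real \<Rightarrow> real^2"
  assumes "simple_path c" "pathfinish c = pathstart c"
  shows "inside (path_image c) \<noteq> {}"
proof
  assume empty: "inside (path_image c) = {}"
  have "path_image c homeomorphic sphere (0::complex) 1"
    using assms by (intro homeomorphic_simple_path_image_circle) auto
  moreover have "sphere (0::complex) 1 homeomorphic sphere (0::real^2) 1"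
    by (rule homeomorphic_spheres_gen) auto
  ultimately have "path_image c homeomorphic sphere (0::real^2) 1" by (rule homeomorphic_trans)
  then have "\<not> connected (- path_image c)" using Jordan_Brouwer_separation by (metis zero_less_one)
  moreover have "- path_image c = outside (path_image c)"
    using inside_Un_outside[of "path_image c"] empty by simp
  moreover have "connected (outside (path_image c))"
    using assms(1) by (intro connected_outside bounded_simple_path_image) auto
  ultimately show False by simp
qed

theorem theorem2p7:
  fixes A :: "(real^2) set"
  assumes "rational_polygon A"
  shows "(\<exists>(k::nat) (r::nat \<Rightarrow> rat) (f::nat \<Rightarrow> rat).
            k > 0 \<and> (\<forall>j\<in>{1..k}. f j > 0) \<and>
            (\<lambda>t::real. E_polygon A t - (\<Sum>j=1..k. of_rat (r j) * E_Delta (of_rat (f j) * t)))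
              \<in> O[at_top](\<lambda>t. t)) \<and>
         (origin_star_shaped A \<longrightarrow>
          (\<exists>(k::nat) (r::nat \<Rightarrow> rat) (f::nat \<Rightarrow> rat).
            k > 0 \<and> (\<forall>j\<in>{1..k}. f j > 0) \<and> (\<forall>j\<in>{1..k}. r j > 0) \<and>
            (\<lambda>t::real. E_polygon A t - (\<Sum>j=1..k. of_rat (r j) * E_Delta (of_rat (f j) * t)))
              \<in> O[at_top](\<lambda>t. t)))"
proof -
  obtain vs where vs: "polygon_with_vertices vs A" "\<forall>v\<in>set vs. v$1 \<in> \<rat> \<and> v$2 \<in> \<rat>"
    using assms unfolding rational_polygon_def by blast
  define c where "c = polygonal_path (vs @ [hd vs])"
  have c: "simple_path c" "A = path_image c \<union> inside (path_image c)"
    using vs(1) by (auto simp: polygon_with_vertices_def c_def Let_def)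
  \<comment> \<open>Without vertices the path would be constant at the unspecified point
    \<open>hd []\<close>, and a constant path is not simple.\<close>
  have "vs \<noteq> []"
  proof
    assume "vs = []"
    then have "c 0 = c (1/2)" by (simp add: c_def linepath_def)
    then show False using c(1) unfolding simple_path_def loop_free_def by fastforce
  qed
  then have "\<forall>v\<in>set (vs @ [hd vs]). v$1 \<in> \<rat> \<and> v$2 \<in> \<rat>" using vs(2) by simp
  from polygonal_path_rational_lines[OF this] obtain L where L: "rational_lines L"
    "path_image c \<subseteq> {p. \<exists>(a,b,d)\<in>L. a * p$1 + b * p$2 = d}" unfolding c_def by blast
  have closed_path: "pathfinish c = pathstart c"
    using polygonal_path_ends[of "vs @ [hd vs]"] \<open>vs \<noteq> []\<close> by (simp add: c_def)
  have compact: "compact (path_image c)" using c(1) by (rule compact_simple_path_image)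
  have "A = - outside (path_image c)" unfolding c(2) by (rule union_with_inside)
  then have "closed A" using open_outside[OF compact_imp_closed[OF compact]] by (simp add: closed_def)
  moreover have bounded: "bounded A"
    unfolding c(2) using compact by (simp add: bounded_inside compact_imp_bounded)
  ultimately have meas: "A \<in> lmeasurable" by (simp add: lmeasurable_compact compact_eq_bounded_closed)
  have "open (inside (path_image c))" using compact by (intro open_inside compact_imp_closed)
  then have "\<not> negligible (inside (path_image c))"
    using inside_simple_closed_path_nonempty[OF c(1) closed_path] by (intro open_not_negligible) auto
  then have "\<not> negligible A" using negligible_subset[of A "inside (path_image c)"] c(2) by auto
  then have pos_measure: "2 * measure lebesgue A \<noteq> 0" using meas by (simp add: negligible_iff_measure)
  \<comment> \<open>\<open>L\<close> covers the boundary, so points on the same side of all its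
    lines are joined by a segment that misses the boundary. The segment stays in one component of
    the complement, and a point of \<open>A\<close> off the boundary is inside.\<close>
  have cell: "q \<in> A" if off: "\<And>u v w. (u,v,w) \<in> L \<Longrightarrow> 0 < (u * p$1 + v * p$2 - w) * (u * q$1 + v * q$2 - w)"
    and p: "p \<in> A" for p q
  proof -
    have "closed_segment p q \<inter> {z. \<exists>(a,b,d)\<in>L. a * z$1 + b * z$2 = d} = {}"
      by (rule segment_avoids_lines) (rule off)
    then have disj: "closed_segment p q \<subseteq> - path_image c" using L(2) by blast
    then have "connected_component (- path_image c) p q"
      unfolding connected_component_def by (intro exI[of _ "closed_segment p q"]) auto
    moreover have "p \<in> inside (path_image c)" using p disj c(2) by auto
    ultimately show "q \<in> A" using inside_same_component c(2) by blast
  qed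
  have comb: "E_Delta_combination pos (E_polygon A) (2 * measure lebesgue A)"
    if star: "pos \<Longrightarrow> origin_star_shaped A" for pos
  proof (rule E_Delta_combination_cells[of A L])
    show "\<theta> *\<^sub>R p \<in> A" if pos "p \<in> A" "0 < \<theta>" "\<theta> \<le> 1" for p \<theta>
      using star[OF that(1)] that(2-4) unfolding origin_star_shaped_def by fastforce
    show "q \<in> A" if "\<And>u v w. (u,v,w) \<in> L \<Longrightarrow> 0 < (u * p$1 + v * p$2 - w) * (u * q$1 + v * q$2 - w)" "p \<in> A" for p q
      using that by (rule cell)
  qed (use bounded meas L(1) in \<open>auto simp: rational_lines_def\<close>)
  show ?thesis
    using E_Delta_combination_indexed[OF comb[of False]] E_Delta_combination_indexed[OF comb[of True]] pos_measure
    by simp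
qed

end
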